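(* Let $K$ be an algebraically closed field, $1\le d\le n-1$, $X\le K^n$ a linear subspace of dimension $d+1$ with Plücker coordinates $(q_I)_{I\in\binom{[n]}{d+1}}$, and $S\subseteq[n]$ such that there is $C\in\binom{[n]}{d+1}$ with $S\subseteq C$ and $q_C\neq0$. Then the linear matroid $\mathcal{M}(L^S(X))$ decomposes into a direct sum $$\mathcal{M}(L^S(X))=\mathcal{M}_S\oplus\mathcal{M}_{S,0}\oplus\bigoplus_{a\in S}\mathcal{M}_{S,a}.$$ Here $\mathcal{M}_S$ is the restriction of $\mathcal{M}(L(X))$ to those $d$-subsets of $[n]$ containing all of $S$; $\mathcal{M}_{S,0}$ is the rank zero matroid on the $d$-subsets missing at least two elements of $S$; and for $a\in S$, $\mathcal{M}_{S,a}$ is a rank one matroid whose ground set consists of the $d$-subsets $J$ with $S\setminus J=\{a\}$, an element $J$ of $\mathcal{M}_{S,a}$ being independent if and only if $q_{J\cup\{a\}}\ne0$.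
   Context: $\mathrm{Gr}(d,n)\subseteq\mathbb{P}^{\binom{n}{d}-1}$ is the Grassmannian in its Plücker embedding; $\mathrm{pr}_S:K^n\to K^n$ kills $e_i$ for $i\in S$ and fixes $e_i$ for $i\notin S$; $L^S(X)=\{Y\in\mathrm{Gr}(d,n):\mathrm{pr}_S(Y)\subseteq X\}$ and $L(X)=L^\emptyset(X)$. Under the hypothesis, $L^S(X)$ and $L(X)$ are projective linear subspaces of $\mathbb{P}^{\binom{n}{d}-1}$ of dimension $d$. For a linear subspace of $\mathbb{P}^{\binom{n}{d}-1}$ whose underlying vector space is the row space of a matrix with columns indexed by $\binom{[n]}{d}$, its linear matroid $\mathcal{M}(\cdot)$ is the matroid on $\binom{[n]}{d}$ of linear dependencies among the columns. *)

theory Defs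
  imports
    "HOL-Analysis.Analysis"
    "HOL-Computational_Algebra.Polynomial"
    "Jordan_Normal_Form.Determinant"
begin

no_notation Matrix.vec_index (infixl "$" 100)

text \<open>
  The index set \<open>[n]\<close> is a finite linearly ordered type \<open>'n\<close>, so that \<open>K\<^sup>n\<close> is \<open>'a ^ 'n\<close>;
  the order is only used to fix the signs of minors.
\<close>

datatype 'e matroid = Matroid (ground: "'e set") (indep: "'e set set")

definition is_matroid :: "'e matroid \<Rightarrow> bool" where
  "is_matroid M \<longleftrightarrow>
     finite (ground M) \<and>
     indep M \<subseteq> Pow (ground M) \<and>
     {} \<in> indep M \<and>
     (\<forall>A\<in>indep M. \<forall>B. B \<subseteq> A \<longrightarrow> B \<in> indep M) \<and>
     (\<forall>A\<in>indep M. \<forall>B\<in>indep M. card A < card B \<longrightarrow> (\<exists>b\<in>B - A. insert b A \<in> indep M))"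

definition matroid_rank :: "'e matroid \<Rightarrow> nat" where
  "matroid_rank M = Max (card ` indep M)"

definition matroid_restrict :: "'e matroid \<Rightarrow> 'e set \<Rightarrow> 'e matroid" where
  "matroid_restrict M F = Matroid (ground M \<inter> F) {A \<in> indep M. A \<subseteq> F}"

text \<open>
  Direct sums are formed inside a common element type, so they are only meaningful for
  summands with pairwise disjoint ground sets.
\<close>

definition direct_sum :: "'e matroid \<Rightarrow> 'e matroid \<Rightarrow> 'e matroid" where
  "direct_sum M N = Matroid (ground M \<union> ground N) {A \<union> B |A B. A \<in> indep M \<and> B \<in> indep N}"

definition direct_sum_family :: "'i set \<Rightarrow> ('i \<Rightarrow> 'e matroid) \<Rightarrow> 'e matroid" where
  "direct_sum_family T M =
     Matroid (\<Union>i\<in>T. ground (M i)) {\<Union>i\<in>T. A i |A. \<forall>i\<in>T. A i \<in> indep (M i)}"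

definition rank_zero_matroid :: "'e set \<Rightarrow> 'e matroid" where
  "rank_zero_matroid E = Matroid E {{}}"

text \<open>Any two elements are dependent; the single element \<open>e\<close> is independent iff \<open>P e\<close>.\<close>

definition rank_one_matroid :: "'e set \<Rightarrow> ('e \<Rightarrow> bool) \<Rightarrow> 'e matroid" where
  "rank_one_matroid E P = Matroid E (insert {} {{e} |e. e \<in> E \<and> P e})"


text \<open>
  A matrix with columns indexed by a set \<open>E\<close> of elements of the finite type \<open>'e\<close> is given by
  the list of its rows, as vectors in \<open>'a ^ 'e\<close> vanishing outside \<open>E\<close>.
  Independence refers to the family of columns: two equal columns are dependent.
\<close>

definition columns_independent :: "('a::field ^ 'e) list \<Rightarrow> 'e set \<Rightarrow> bool" where
  "columns_independent rs A \<longleftrightarrow>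
     (\<forall>c. (\<forall>r\<in>set rs. (\<Sum>e\<in>A. c e * r $ e) = 0) \<longrightarrow> (\<forall>e\<in>A. c e = 0))"

definition linear_matroid :: "'e set \<Rightarrow> ('a::field ^ 'e) set \<Rightarrow> 'e matroid" where
  "linear_matroid E V =
     Matroid E {A. A \<subseteq> E \<and> (\<exists>rs. vec.span (set rs) = V \<and> columns_independent rs A)}"


definition Gr :: "nat \<Rightarrow> ('a::field ^ 'n) set set" where
  "Gr d = {Y. vec.subspace Y \<and> vec.dim Y = d}"

text \<open>
  The minor of the matrix with rows \<open>b\<close> in the columns \<open>I\<close>, taken in increasing order.
\<close>

definition maximal_minor :: "('a::field ^ 'n::{finite,linorder}) list \<Rightarrow> 'n set \<Rightarrow> 'a" where
  "maximal_minor b I =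
     Determinant.det (Matrix.mat (length b) (length b)
       (\<lambda>(i, j). (b ! i) $ (sorted_list_of_set I ! j)))"

text \<open>
  A vector in \<open>K\<close> to the power \<open>n\<close> over \<open>k\<close> is a vector indexed by all subsets of \<open>[n]\<close> that
  vanishes outside the \<open>k\<close>-subsets.  Pluecker vectors depend on the choice of a basis \<open>b\<close>,
  that is, they are determined up to a nonzero scalar, whence a relation.
\<close>

definition is_pluecker_vector ::
    "nat \<Rightarrow> ('a::field ^ 'n::{finite,linorder}) set \<Rightarrow> 'a ^ ('n set) \<Rightarrow> bool" where
  "is_pluecker_vector k Y p \<longleftrightarrow>
     (\<exists>b. length b = k \<and> distinct b \<and> vec.independent (set b) \<and> vec.span (set b) = Y \<and>
          p = (\<chi> I. if card I = k then maximal_minor b I else 0))"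

text \<open>
  The affine cone over the image of \<open>\<Y> \<subseteq> Gr d\<close> under the Pluecker embedding; if the image is a
  projective linear subspace, this is its underlying vector space.
\<close>

definition pluecker_cone ::
    "nat \<Rightarrow> ('a::field ^ 'n::{finite,linorder}) set set \<Rightarrow> ('a ^ ('n set)) set" where
  "pluecker_cone d \<Y> = insert 0 {p. \<exists>Y\<in>\<Y>. is_pluecker_vector d Y p}"

definition pr :: "'n set \<Rightarrow> 'a::field ^ 'n \<Rightarrow> 'a ^ 'n" where
  "pr S x = (\<chi> i. if i \<in> S then 0 else x $ i)"

definition LS :: "nat \<Rightarrow> 'n set \<Rightarrow> ('a::field ^ 'n) set \<Rightarrow> ('a ^ 'n) set set" where
  "LS d S X = {Y \<in> Gr d. pr S ` Y \<subseteq> X}"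

abbreviation L :: "nat \<Rightarrow> ('a::field ^ 'n) set \<Rightarrow> ('a ^ 'n) set set" where
  "L d X \<equiv> LS d {} X"

definition matroid_LS ::
    "nat \<Rightarrow> 'n set \<Rightarrow> ('a::field ^ 'n::{finite,linorder}) set \<Rightarrow> 'n set matroid" where
  "matroid_LS d S X = linear_matroid {J. card J = d} (pluecker_cone d (LS d S X))"


definition summand ::
    "nat \<Rightarrow> 'n set \<Rightarrow> ('a::field ^ 'n::{finite,linorder}) set \<Rightarrow> 'n set matroid" where
  "summand d S X = matroid_restrict (matroid_LS d {} X) {J. S \<subseteq> J}"

definition summand_zero :: "nat \<Rightarrow> 'n::finite set \<Rightarrow> 'n set matroid" where
  "summand_zero d S = rank_zero_matroid {J. card J = d \<and> 2 \<le> card (S - J)}"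

definition summand_at :: "nat \<Rightarrow> 'n::finite set \<Rightarrow> 'a::field ^ ('n set) \<Rightarrow> 'n \<Rightarrow> 'n set matroid" where
  "summand_at d S q a =
     rank_one_matroid {J. card J = d \<and> S - J = {a}} (\<lambda>J. q $ (J \<union> {a}) \<noteq> 0)"


lemma LS_empty:
  fixes X :: "('a::field ^ 'n) set"
  shows "L d X = {Y \<in> Gr d. Y \<subseteq> X}"
proof -
  have "pr {} = (\<lambda>x :: 'a ^ 'n. x)"
    by (simp add: pr_def fun_eq_iff vec_eq_iff)
  then show ?thesis
    by (simp add: LS_def)
qed

text \<open>The linear matroid does not depend on the matrix representing the subspace.\<close>

lemma columns_independent_iff_span:
  fixes rs :: "('a::field ^ 'e::finite) list"
  shows "columns_independent rs A \<longleftrightarrow>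
    (\<forall>c. (\<forall>v\<in>vec.span (set rs). (\<Sum>e\<in>A. c e * v $ e) = 0) \<longrightarrow> (\<forall>e\<in>A. c e = 0))"
proof -
  have "(\<forall>r\<in>set rs. (\<Sum>e\<in>A. c e * r $ e) = 0) \<longleftrightarrow>
        (\<forall>v\<in>vec.span (set rs). (\<Sum>e\<in>A. c e * v $ e) = 0)" for c :: "'e \<Rightarrow> 'a"
  proof -
    have "vec.subspace {v :: 'a ^ 'e. (\<Sum>e\<in>A. c e * v $ e) = 0}"
    proof (rule vec.subspaceI)
      fix x y :: "'a ^ 'e"
      assume "x \<in> {v. (\<Sum>e\<in>A. c e * v $ e) = 0}" "y \<in> {v. (\<Sum>e\<in>A. c e * v $ e) = 0}"
      then show "x + y \<in> {v. (\<Sum>e\<in>A. c e * v $ e) = 0}"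
        by (simp add: distrib_left sum.distrib)
    next
      fix k :: 'a and x :: "'a ^ 'e"
      assume x: "x \<in> {v. (\<Sum>e\<in>A. c e * v $ e) = 0}"
      have "(\<Sum>e\<in>A. c e * (k *s x) $ e) = k * (\<Sum>e\<in>A. c e * x $ e)"
        by (simp add: sum_distrib_left mult.left_commute)
      then show "k *s x \<in> {v. (\<Sum>e\<in>A. c e * v $ e) = 0}"
        using x by simp
    qed simp
    then have "set rs \<subseteq> {v. (\<Sum>e\<in>A. c e * v $ e) = 0} \<Longrightarrow>
        vec.span (set rs) \<subseteq> {v. (\<Sum>e\<in>A. c e * v $ e) = 0}"
      by (rule vec.span_minimal[rotated])
    then show ?thesis
      using vec.span_superset[of "set rs"] by blast
  qed
  then show ?thesis
    unfolding columns_independent_def by simp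
qed

lemma indep_linear_matroid:
  fixes rs :: "('a::field ^ 'e::finite) list"
  assumes "vec.span (set rs) = V"
  shows "indep (linear_matroid E V) = {A. A \<subseteq> E \<and> columns_independent rs A}"
  using assms unfolding linear_matroid_def by (auto simp: columns_independent_iff_span)

lemma dependent_family:
  fixes f :: "'b \<Rightarrow> 'a::field ^ 'e::finite"
  assumes "finite B" "finite T" "f ` B \<subseteq> vec.span T" "card T < card B"
  shows "\<exists>c. (\<Sum>b\<in>B. c b *s f b) = 0 \<and> (\<exists>b\<in>B. c b \<noteq> 0)"
proof (cases "inj_on f B")
  case True
  then have "card (f ` B) > card T"
    using assms(4) by (simp add: card_image)
  then have "vec.dependent (f ` B)"
    using vec.independent_span_bound[OF assms(2) _ assms(3)] by force
  then obtain u where u: "\<exists>v\<in>f ` B. u v \<noteq> 0" "(\<Sum>v\<in>f ` B. u v *s v) = 0"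
    using vec.dependent_finite[of "f ` B"] assms(1) by auto
  have "(\<Sum>b\<in>B. u (f b) *s f b) = 0"
    using u(2) by (simp add: sum.reindex[OF True])
  then show ?thesis
    using u(1) by (intro exI[of _ "\<lambda>b. u (f b)"]) auto
next
  case False
  then obtain x y where xy: "x \<in> B" "y \<in> B" "x \<noteq> y" "f x = f y"
    by (auto simp: inj_on_def)
  define c where "c b = (if b = x then 1 else if b = y then - 1 else 0 :: 'a)" for b
  have "(\<Sum>b\<in>B. c b *s f b) = (\<Sum>b\<in>{x, y}. c b *s f b)"
    using xy assms(1) by (intro sum.mono_neutral_right) (auto simp: c_def)
  also have "\<dots> = 0"
    using xy by (simp add: c_def)
  finally show ?thesis
    using xy by (intro exI[of _ c]) (auto simp: c_def)
qed

lemma is_matroid_linear_matroid: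
  fixes V :: "('a::field ^ 'e::finite) set"
  assumes "vec.subspace V"
  shows "is_matroid (linear_matroid E V)"
proof -
  obtain Bs where Bs: "Bs \<subseteq> V" "vec.independent Bs" "V \<subseteq> vec.span Bs"
    using vec.maximal_independent_subset by blast
  have "finite Bs"
    using Bs(2) vec.finiteI_independent by blast
  then obtain rs where rs: "set rs = Bs"
    using finite_list by blast
  have span: "vec.span (set rs) = V"
    using Bs rs assms vec.span_minimal by blast
  note ind = indep_linear_matroid[OF span, of E]
  have mono: "columns_independent rs B" if "columns_independent rs A" "B \<subseteq> A" for A B
    unfolding columns_independent_def
  proof (intro allI impI)
    fix c assume c: "\<forall>r\<in>set rs. (\<Sum>e\<in>B. c e * r $ e) = 0"
    define c' where "c' e = (if e \<in> B then c e else 0)" for e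
    have "(\<Sum>e\<in>A. c' e * r $ e) = (\<Sum>e\<in>B. c e * r $ e)" for r
      using that(2) by (intro sum.mono_neutral_cong_right) (auto simp: c'_def)
    then have "\<forall>e\<in>A. c' e = 0"
      using c that(1) unfolding columns_independent_def by simp
    then show "\<forall>e\<in>B. c e = 0"
      using that(2) by (auto simp: c'_def split: if_splits)
  qed
  have aug: "\<exists>b\<in>B - A. columns_independent rs (insert b A)"
    if A: "columns_independent rs A" and B: "columns_independent rs B" and card: "card A < card B"
    for A B
  proof (rule ccontr)
    assume none: "\<not> ?thesis"
    have "\<exists>m. \<forall>r\<in>set rs. r $ b = (\<Sum>a\<in>A. m a * r $ a)" if "b \<in> B" for b
    proof (cases "b \<in> A")
      case True
      have "r $ b = (\<Sum>a\<in>A. (if a = b then 1 else 0) * r $ a)" for r :: "'a ^ 'e"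
        using True by (simp add: if_distrib[where f = "\<lambda>x. x * _"] cong: if_cong)
      then show ?thesis
        by (intro exI[of _ "\<lambda>a. if a = b then 1 else 0"]) blast
    next
      case False
      then have "\<not> columns_independent rs (insert b A)"
        using none that by blast
      then obtain c where c: "\<forall>r\<in>set rs. (\<Sum>e\<in>insert b A. c e * r $ e) = 0"
        and nz: "\<exists>e\<in>insert b A. c e \<noteq> 0"
        unfolding columns_independent_def by blast
      have c': "c b * r $ b + (\<Sum>e\<in>A. c e * r $ e) = 0" if "r \<in> set rs" for r
        using c that False by simp
      have "c b \<noteq> 0"
      proof
        assume "c b = 0"
        then have "\<forall>e\<in>A. c e = 0"
          using c' A unfolding columns_independent_def by simp
        then show False
          using nz \<open>c b = 0\<close> by blast
      qed
      have "r $ b = (\<Sum>a\<in>A. (- c a / c b) * r $ a)" if "r \<in> set rs" for r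
      proof -
        have "(\<Sum>a\<in>A. (- c a / c b) * r $ a) = - (\<Sum>e\<in>A. c e * r $ e) / c b"
          by (simp add: sum_negf sum_divide_distrib)
        also have "- (\<Sum>e\<in>A. c e * r $ e) = c b * r $ b"
          using c'[OF that] by (simp add: add_eq_0_iff2)
        finally show ?thesis
          using \<open>c b \<noteq> 0\<close> by simp
      qed
      then show ?thesis
        by (intro exI[of _ "\<lambda>a. - c a / c b"]) blast
    qed
    then obtain m where m: "\<And>b r. b \<in> B \<Longrightarrow> r \<in> set rs \<Longrightarrow> r $ b = (\<Sum>a\<in>A. m b a * r $ a)"
      by metis
    define f where "f b = (\<Sum>a\<in>A. m b a *s axis a (1::'a))" for b
    have f_nth: "f b $ a = (if a \<in> A then m b a else 0)" for b a
      by (simp add: f_def axis_def if_distrib[where f = "\<lambda>x. _ * x"] cong: if_cong)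
    have "f ` B \<subseteq> vec.span ((\<lambda>a. axis a 1) ` A)"
      unfolding f_def by (intro image_subsetI vec.span_sum vec.span_scale vec.span_base imageI)
    moreover have "card ((\<lambda>a. axis a (1::'a)) ` A) < card B"
      using card card_image_le[of A "\<lambda>a. axis a (1::'a)"] by simp
    ultimately obtain c where c: "(\<Sum>b\<in>B. c b *s f b) = 0" "\<exists>b\<in>B. c b \<noteq> 0"
      using dependent_family[of B "(\<lambda>a. axis a 1) ` A" f] by auto
    have z: "(\<Sum>b\<in>B. c b * m b a) = 0" if "a \<in> A" for a
    proof -
      have "(\<Sum>b\<in>B. c b *s f b) $ a = 0"
        using c(1) by simp
      then show ?thesis
        using that by (simp add: f_nth)
    qed
    have "(\<Sum>b\<in>B. c b * r $ b) = 0" if "r \<in> set rs" for r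
    proof -
      have "(\<Sum>b\<in>B. c b * r $ b) = (\<Sum>b\<in>B. \<Sum>a\<in>A. c b * m b a * r $ a)"
        using m that by (simp add: sum_distrib_left mult.assoc)
      also have "\<dots> = (\<Sum>a\<in>A. (\<Sum>b\<in>B. c b * m b a) * r $ a)"
        by (subst sum.swap) (simp add: sum_distrib_right)
      finally show ?thesis
        using z by simp
    qed
    then show False
      using B c(2) unfolding columns_independent_def by blast
  qed
  show ?thesis
    unfolding is_matroid_def ind
  proof (intro conjI ballI allI impI)
    show "finite (ground (linear_matroid E V))"
      by simp
    show "{A. A \<subseteq> E \<and> columns_independent rs A} \<subseteq> Pow (ground (linear_matroid E V))"
      by (auto simp: linear_matroid_def)
    show "{} \<in> {A. A \<subseteq> E \<and> columns_independent rs A}"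
      by (simp add: columns_independent_def)
  next
    fix A B assume "A \<in> {A. A \<subseteq> E \<and> columns_independent rs A}" "B \<subseteq> A"
    then show "B \<in> {A. A \<subseteq> E \<and> columns_independent rs A}"
      using mono by blast
  next
    fix A B assume A: "A \<in> {A. A \<subseteq> E \<and> columns_independent rs A}"
      and B: "B \<in> {A. A \<subseteq> E \<and> columns_independent rs A}" and "card A < card B"
    then obtain b where "b \<in> B - A" "columns_independent rs (insert b A)"
      using aug[of A B] by blast
    then show "\<exists>b\<in>B - A. insert b A \<in> {A. A \<subseteq> E \<and> columns_independent rs A}"
      using A B by blast
  qed
qed

lemma is_matroid_restrict:
  assumes "is_matroid M"
  shows "is_matroid (matroid_restrict M F)"
  unfolding is_matroid_def
proof (intro conjI ballI allI impI)
  show "finite (ground (matroid_restrict M F))"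
    using assms by (simp add: is_matroid_def matroid_restrict_def)
  show "indep (matroid_restrict M F) \<subseteq> Pow (ground (matroid_restrict M F))"
    using assms unfolding is_matroid_def matroid_restrict_def by auto
  show "{} \<in> indep (matroid_restrict M F)"
    using assms by (simp add: is_matroid_def matroid_restrict_def)
next
  fix A B assume "A \<in> indep (matroid_restrict M F)" "B \<subseteq> A"
  then have "A \<in> indep M" "A \<subseteq> F" "B \<subseteq> A"
    by (simp_all add: matroid_restrict_def)
  moreover have "\<forall>A\<in>indep M. \<forall>B. B \<subseteq> A \<longrightarrow> B \<in> indep M"
    using assms unfolding is_matroid_def by (elim conjE)
  ultimately show "B \<in> indep (matroid_restrict M F)"
    by (auto simp: matroid_restrict_def)
next
  fix A B
  assume A: "A \<in> indep (matroid_restrict M F)" and B: "B \<in> indep (matroid_restrict M F)"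
    and "card A < card B"
  then have "A \<in> indep M" "B \<in> indep M"
    by (simp_all add: matroid_restrict_def)
  moreover have "\<forall>A\<in>indep M. \<forall>B\<in>indep M. card A < card B \<longrightarrow> (\<exists>b\<in>B - A. insert b A \<in> indep M)"
    using assms unfolding is_matroid_def by (elim conjE)
  ultimately obtain b where "b \<in> B - A" "insert b A \<in> indep M"
    using \<open>card A < card B\<close> by blast
  then show "\<exists>b\<in>B - A. insert b A \<in> indep (matroid_restrict M F)"
    using A B by (auto simp: matroid_restrict_def)
qed

lemma is_matroid_rank_zero: "finite E \<Longrightarrow> is_matroid (rank_zero_matroid E)"
  by (simp add: is_matroid_def rank_zero_matroid_def)

lemma is_matroid_rank_one:
  assumes "finite E"
  shows "is_matroid (rank_one_matroid E P)"
proof -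
  have indep: "A \<in> indep (rank_one_matroid E P) \<longleftrightarrow> A = {} \<or> (\<exists>e\<in>E. P e \<and> A = {e})" for A
    by (auto simp: rank_one_matroid_def)
  show ?thesis
    unfolding is_matroid_def
  proof (intro conjI ballI allI impI)
    show "finite (ground (rank_one_matroid E P))"
      using assms by (simp add: rank_one_matroid_def)
    show "indep (rank_one_matroid E P) \<subseteq> Pow (ground (rank_one_matroid E P))"
      by (auto simp: rank_one_matroid_def)
    show "{} \<in> indep (rank_one_matroid E P)"
      by (simp add: indep)
  next
    fix A B assume "A \<in> indep (rank_one_matroid E P)" "B \<subseteq> A"
    then show "B \<in> indep (rank_one_matroid E P)"
      unfolding indep by blast
  next
    fix A B
    assume A: "A \<in> indep (rank_one_matroid E P)" and B: "B \<in> indep (rank_one_matroid E P)"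
      and card: "card A < card B"
    have "card B \<le> 1"
      using B unfolding indep by auto
    then have "card A = 0"
      using card by linarith
    then have "A = {}"
      using A unfolding indep by auto
    moreover have "B \<noteq> {}"
      using card by auto
    ultimately show "\<exists>b\<in>B - A. insert b A \<in> indep (rank_one_matroid E P)"
      using B unfolding indep by blast
  qed
qed

lemma rank_one_matroid_indep_singleton:
  "e \<in> ground (rank_one_matroid E P) \<Longrightarrow> {e} \<in> indep (rank_one_matroid E P) \<longleftrightarrow> P e"
  by (auto simp: rank_one_matroid_def)

lemma summands_disjoint:
  "ground (summand d S X) \<inter> ground (summand_zero d S) = {}"
  "ground (summand d S X) \<inter> ground (summand_at d S q a) = {}"
  "ground (summand_zero d S) \<inter> ground (summand_at d S q a) = {}"
  "a \<noteq> b \<Longrightarrow> ground (summand_at d S q a) \<inter> ground (summand_at d S q b) = {}"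
proof -
  have S: "ground (summand d S X) = {J. card J = d \<and> S - J = {}}"
    by (simp only: summand_def matroid_restrict_def matroid_LS_def linear_matroid_def matroid.sel
        Diff_eq_empty_iff) blast
  have Z: "ground (summand_zero d S) = {J. card J = d \<and> 2 \<le> card (S - J)}"
    by (simp only: summand_zero_def rank_zero_matroid_def matroid.sel)
  have A: "ground (summand_at d S q a) = {J. card J = d \<and> S - J = {a}}" for a
    by (simp only: summand_at_def rank_one_matroid_def matroid.sel)
  have "\<not> 2 \<le> card (S - J)" if "S - J = {}" for J
    unfolding that by simp
  then show "ground (summand d S X) \<inter> ground (summand_zero d S) = {}"
    unfolding S Z by blast
  show "ground (summand d S X) \<inter> ground (summand_at d S q a) = {}"
    unfolding S A by blast
  have "\<not> 2 \<le> card (S - J)" if "S - J = {a}" for J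
    unfolding that by simp
  then show "ground (summand_zero d S) \<inter> ground (summand_at d S q a) = {}"
    unfolding Z A by blast
  show "ground (summand_at d S q a) \<inter> ground (summand_at d S q b) = {}" if "a \<noteq> b"
    unfolding A using that by blast
qed

end

theory Submission
  imports Defs
begin

text \<open>
  The variety \<open>L\<^sup>S(X)\<close> is itself of the form \<open>L(X')\<close>: the condition \<open>pr S ` Y \<subseteq> X\<close> says that \<open>Y\<close> lies in
  the preimage \<open>X'\<close> of \<open>X\<close> under \<open>pr S\<close>, and the hypothesis on \<open>C\<close> makes \<open>X'\<close> a subspace of dimension
  \<open>d + 1\<close> again.  So it suffices to describe \<open>L(X)\<close> in terms of the Pluecker vector of \<open>X\<close>, and then to
  compare the Pluecker vectors \<open>q\<close> of \<open>X\<close> and \<open>q'\<close> of \<open>X'\<close>.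

  A hyperplane of \<open>X\<close> is the kernel of a functional \<open>\<phi>\<close>, and its Pluecker vector is the contraction of
  \<open>q\<close> by \<open>\<phi>\<close>, with entry \<open>\<Sum>k\<in>-J. \<plusminus> \<phi> $ k * q $ (insert k J)\<close> at \<open>J\<close>.  This is lemma
  \<open>pluecker_cone_hyperplanes\<close>; it exhibits the underlying vector space of \<open>L(X)\<close> as the row space of a
  matrix whose column at \<open>J\<close> is the vector with entries \<open>\<plusminus> q $ (insert k J)\<close>, zero for \<open>k \<in> J\<close>.

  Up to a scalar, \<open>q'\<close> arises from \<open>q\<close> by setting the entries at all \<open>I\<close> not containing \<open>S\<close> to zero
  (lemma \<open>pluecker_vector_pr_vimage\<close>): in a basis of \<open>X\<close> that is the identity in the columns \<open>C\<close>, it is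
  enough to replace the vectors belonging to \<open>S\<close> by unit vectors.

  Both facts together make the decomposition visible in the columns of the matrix for \<open>X'\<close>.  A column
  at \<open>J\<close> missing two elements of \<open>S\<close> is zero; a column with \<open>S - J = {a}\<close> is the multiple
  \<open>\<plusminus> q' $ (insert a J)\<close> of the unit vector at \<open>a\<close>; a column with \<open>S \<subseteq> J\<close> is the column
  for \<open>X\<close> times a nonzero scalar that is the same for all \<open>J\<close>, and has no entries in \<open>S\<close> (lemma \<open>independent_family_decompose\<close>).
\<close>

section \<open>Subspaces spanned by lists of vectors\<close>

abbreviation pairing :: "'a::field ^ 'n::finite \<Rightarrow> 'a ^ 'n \<Rightarrow> 'a" where
  "pairing \<phi> v \<equiv> (\<Sum>k\<in>UNIV. \<phi> $ k * v $ k)"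

text \<open>
  Length and span alone show that a list is a basis.  Hence a Pluecker vector can be recognised
  without an independence check, which is useful when a basis is modified one vector at a time.
\<close>

lemma vec_basis_list:
  fixes b :: "('a::field ^ 'n::finite) list"
  assumes "vec.span (set b) = X" "length b = vec.dim X"
  shows "distinct b" "vec.independent (set b)"
proof -
  have X: "set b \<subseteq> X"
    using assms(1) vec.span_superset by blast
  have "vec.dim X \<le> card (set b)"
    using X assms(1) by (intro vec.span_card_ge_dim) auto
  then have "card (set b) = length b"
    using card_length[of b] assms(2) by linarith
  then show "distinct b"
    by (rule card_distinct)
  show "vec.independent (set b)"
    using X assms \<open>card (set b) = length b\<close> by (intro vec.card_le_dim_spanning[of _ X]) auto
qed

lemma vec_span_list:
  fixes b :: "('a::field ^ 'n::finite) list"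
  assumes "v \<in> vec.span (set b)"
  shows "\<exists>g. v = (\<Sum>l<length b. g l *s b ! l)"
proof -
  let ?T = "range (\<lambda>g. \<Sum>l<length b. g l *s b ! l)"
  have "vec.subspace ?T"
  proof (rule vec.subspaceI)
    show "0 \<in> ?T"
      by (rule range_eqI[of _ _ "\<lambda>_. 0"]) simp
  next
    fix x y assume "x \<in> ?T" "y \<in> ?T"
    then obtain g h where "x = (\<Sum>l<length b. g l *s b ! l)" "y = (\<Sum>l<length b. h l *s b ! l)"
      by blast
    then show "x + y \<in> ?T"
      by (intro range_eqI[of _ _ "\<lambda>l. g l + h l"]) (simp add: vec.scale_left_distrib sum.distrib)
  next
    fix r x assume "x \<in> ?T"
    then obtain g where "x = (\<Sum>l<length b. g l *s b ! l)"
      by blast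
    then show "r *s x \<in> ?T"
      by (intro range_eqI[of _ _ "\<lambda>l. r * g l"]) (simp add: vec.scale_sum_right)
  qed
  moreover have "set b \<subseteq> ?T"
  proof
    fix w assume "w \<in> set b"
    then obtain i where "i < length b" "w = b ! i"
      by (auto simp: in_set_conv_nth)
    then show "w \<in> ?T"
      by (intro range_eqI[of _ _ "\<lambda>l. if l = i then 1 else 0"])
         (simp add: if_distrib[where f = "\<lambda>x. x *s _"] cong: if_cong)
  qed
  ultimately show ?thesis
    using vec.span_minimal assms by blast
qed

lemma vec_span_list_rows:
  fixes b c :: "('a::field ^ 'n::finite) list"
  assumes "set c \<subseteq> vec.span (set b)"
  shows "\<exists>G. \<forall>i<length c. c ! i = (\<Sum>l<length b. G i l *s b ! l)"
proof -
  have "\<forall>i. \<exists>g. i < length c \<longrightarrow> c ! i = (\<Sum>l<length b. g l *s b ! l)"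
    using vec_span_list assms by (metis nth_mem subsetD)
  then show ?thesis
    by metis
qed

lemma vec_extend_basis_list:
  fixes X :: "('a::field ^ 'n::finite) set"
  assumes "vec.subspace X" "vec.dim X = Suc (length y)"
    and "set y \<subseteq> X" "vec.independent (set y)" "distinct y"
  shows "\<exists>z. z \<notin> vec.span (set y) \<and> vec.span (set (y @ [z])) = X"
proof -
  have dim: "vec.dim (set y) = length y"
    using assms(4,5) by (simp add: vec.dim_eq_card_independent distinct_card)
  obtain z where z: "z \<in> X" "z \<notin> vec.span (set y)"
    using assms(2) dim vec.dim_mono[of X "set y"] by auto
  have sub: "vec.span (set (y @ [z])) \<subseteq> X"
    using assms(1,3) z(1) by (intro vec.span_minimal) auto
  moreover have "vec.dim (vec.span (set (y @ [z]))) = Suc (length y)"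
    using z(2) dim by (simp add: vec.dim_insert)
  ultimately have "vec.span (set (y @ [z])) = X"
    using assms(1,2) by (intro vec.subspace_dim_equal) auto
  then show ?thesis
    using z(2) by blast
qed

lemma vec_separating_functional:
  fixes y :: "('a::field ^ 'n::finite) set"
  assumes "vec.independent y" "z \<notin> vec.span y"
  shows "\<exists>\<phi>. (\<forall>v\<in>y. pairing \<phi> v = 0) \<and> pairing \<phi> z = 1"
proof -
  have "vec.independent (insert z y)"
    using assms(2,1) by (rule vec.independent_insertI)
  have "z \<notin> y"
    using assms(2) vec.span_base by blast
  obtain i :: 'n where True by blast
  obtain g where g: "Vector_Spaces.linear (*s) (*s) g"
    "\<forall>x\<in>insert z y. g x = (if x = z then axis i (1::'a) else 0)"
    using vec.linear_independent_extend[OF \<open>vec.independent (insert z y)\<close>,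
      of "\<lambda>x. if x = z then axis i 1 else 0"] by auto
  have "pairing (matrix g $ i) v = g v $ i" for v
    using matrix_works[OF g(1), of v] by (simp add: matrix_vector_mult_def Finite_Cartesian_Product.vec_eq_iff)
  then show ?thesis
    using g(2) \<open>z \<notin> y\<close> by (intro exI[of _ "matrix g $ i"]) (auto simp: axis_def)
qed

lemma pairing_add: "pairing \<phi> (v + w) = pairing \<phi> v + pairing \<phi> w"
  by (simp add: distrib_left sum.distrib)

lemma pairing_scale: "pairing \<phi> (r *s v) = r * pairing \<phi> v"
  by (simp add: sum_distrib_left mult.left_commute)

text \<open>
  One linear equation lowers the dimension by at most one.  So every functional vanishes on some
  \<open>d\<close>-dimensional subspace of \<open>X\<close>, which is the hyperplane corresponding to it unless it is zero on \<open>X\<close>.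
\<close>

lemma vec_dim_kernel:
  fixes X :: "('a::field ^ 'n::finite) set"
  assumes "vec.subspace X" "vec.dim X = Suc d"
  shows "d \<le> vec.dim (X \<inter> {v. pairing \<phi> v = 0})"
proof (cases "\<exists>z\<in>X. pairing \<phi> z \<noteq> 0")
  case True
  then obtain z where z: "z \<in> X" "pairing \<phi> z \<noteq> 0"
    by blast
  let ?W = "X \<inter> {v. pairing \<phi> v = 0}"
  have "X \<subseteq> vec.span (insert z ?W)"
  proof
    fix x assume "x \<in> X"
    define r where "r = pairing \<phi> x / pairing \<phi> z"
    have "pairing \<phi> (x - r *s z) = pairing \<phi> x - r * pairing \<phi> z"
      using pairing_add[of \<phi> "x - r *s z" "r *s z"] pairing_scale[of \<phi> r z] by simp
    then have "x - r *s z \<in> ?W"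
      using z \<open>x \<in> X\<close> assms(1) by (simp add: r_def vec.subspace_diff vec.subspace_scale)
    then have "(x - r *s z) + r *s z \<in> vec.span (insert z ?W)"
      by (intro vec.span_add vec.span_scale vec.span_base) auto
    then show "x \<in> vec.span (insert z ?W)"
      by simp
  qed
  then have "vec.dim X \<le> vec.dim (insert z ?W)"
    by (rule vec.dim_mono)
  then show ?thesis
    using assms(2) by (simp add: vec.dim_insert split: if_splits)
next
  case False
  then have "X \<inter> {v. pairing \<phi> v = 0} = X"
    by blast
  then show ?thesis
    using assms(2) by simp
qed

text \<open>
  A list whose entries in the columns \<open>cs\<close> form an identity matrix behaves like a basis with known
  coordinate functionals: the coefficients of a vector in its span are the entries of the vector
  itself.
\<close>

lemma vec_dual_coordinates_expansion:
  fixes x :: "('a::field ^ 'n::finite) list"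
  assumes "\<And>i j. i < length x \<Longrightarrow> j < length x \<Longrightarrow> (x ! i) $ (cs ! j) = (if i = j then 1 else 0)"
    and "v \<in> vec.span (set x)"
  shows "v = (\<Sum>l<length x. v $ (cs ! l) *s x ! l)"
proof -
  obtain g where g: "v = (\<Sum>l<length x. g l *s x ! l)"
    using vec_span_list[OF assms(2)] by blast
  have "v $ (cs ! j) = g j" if "j < length x" for j
    unfolding g using that assms(1) by (simp add: if_distrib[where f = "\<lambda>x. _ * x"] cong: if_cong)
  then show ?thesis
    by (subst g) simp
qed

lemma vec_dual_coordinates_independent:
  fixes x :: "('a::field ^ 'n::finite) list"
  assumes "\<And>i j. i < length x \<Longrightarrow> j < length x \<Longrightarrow> (x ! i) $ (cs ! j) = (if i = j then 1 else 0)"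
  shows "distinct x" "vec.independent (set x)"
proof -
  show dist: "distinct x"
    unfolding distinct_conv_nth using assms by (metis zero_neq_one)
  show "vec.independent (set x)"
  proof
    assume "vec.dependent (set x)"
    then obtain u where u: "\<exists>v\<in>set x. u v \<noteq> 0" "(\<Sum>v\<in>set x. u v *s v) = 0"
      using vec.dependent_finite[of "set x"] by auto
    have "(\<Sum>l<length x. u (x ! l) *s x ! l) = 0"
      using u(2) sum.reindex_bij_betw[OF bij_betw_nth[OF dist refl refl], of "\<lambda>v. u v *s v"]
      by simp
    then have zero: "(\<Sum>l<length x. u (x ! l) *s x ! l) $ (cs ! j) = 0" for j
      by simp
    have "u (x ! j) = 0" if "j < length x" for j
    proof -
      have "(\<Sum>l<length x. u (x ! l) *s x ! l) $ (cs ! j) =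
          (\<Sum>l<length x. u (x ! l) * (if l = j then 1 else 0))"
        using that assms by simp
      also have "\<dots> = u (x ! j)"
        using that by (simp add: if_distrib[where f = "\<lambda>x. _ * x"] cong: if_cong)
      finally show ?thesis
        using zero by simp
    qed
    then show False
      using u(1) by (auto simp: in_set_conv_nth)
  qed
qed

section \<open>Minors with an arbitrary order of columns\<close>

definition column_minor :: "('a::field ^ 'n::finite) list \<Rightarrow> 'n list \<Rightarrow> 'a" where
  "column_minor b ks =
     Determinant.det (Matrix.mat (length b) (length b) (\<lambda>(i, j). (b ! i) $ (ks ! j)))"

text \<open>
  All determinants below are built from linear functionals \<open>f j\<close> evaluated on the vectors of a list.
  Replacing the list by linear combinations of its entries multiplies the matrix from the left,
  whatever the functionals are, so one statement covers minors and bordered minors.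
\<close>

lemma det_row_combination:
  fixes f g :: "nat \<Rightarrow> nat \<Rightarrow> 'a::field"
  assumes "\<And>i j. i < m \<Longrightarrow> j < m \<Longrightarrow> g i j = (\<Sum>l<m. G i l * f l j)"
  shows "Determinant.det (Matrix.mat m m (\<lambda>(i, j). g i j)) =
    Determinant.det (Matrix.mat m m (\<lambda>(i, j). G i j)) * Determinant.det (Matrix.mat m m (\<lambda>(i, j). f i j))"
proof -
  have "Matrix.mat m m (\<lambda>(i, j). g i j) = Matrix.mat m m (\<lambda>(i, j). G i j) * Matrix.mat m m (\<lambda>(i, j). f i j)"
    by (rule eq_matI) (auto simp: assms scalar_prod_def atLeast0LessThan)
  then show ?thesis
    by (simp add: Determinant.det_mult[of _ m])
qed

lemma maximal_minor_eq_column_minor: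
  "maximal_minor b I = column_minor b (sorted_list_of_set I)"
  by (simp add: maximal_minor_def column_minor_def)

lemma column_minor_row_combination:
  assumes "length c = length b" "\<And>i. i < length b \<Longrightarrow> c ! i = (\<Sum>l<length b. G i l *s b ! l)"
  shows "column_minor c ks =
    Determinant.det (Matrix.mat (length b) (length b) (\<lambda>(i, j). G i j)) * column_minor b ks"
  unfolding column_minor_def assms(1)
  by (rule det_row_combination) (simp add: assms(2))

lemma column_minor_repeated:
  assumes "length ks = length b" "\<not> distinct ks"
  shows "column_minor b ks = 0"
proof -
  obtain i j where "i < length b" "j < length b" "i \<noteq> j" "ks ! i = ks ! j"
    using assms by (auto simp: distinct_conv_nth)
  then show ?thesis
    unfolding column_minor_def
    by (intro det_identical_columns[of _ "length b" i j]) (auto intro!: eq_vecI)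
qed

lemma column_minor_permute:
  assumes "p permutes {..<length b}" "length ks = length b"
  shows "column_minor b (permute_list p ks) = signof p * column_minor b ks"
proof -
  let ?m = "length b"
  let ?A = "Matrix.mat ?m ?m (\<lambda>(i, j). (b ! j) $ (ks ! i))"
  have p: "p permutes {0..<?m}"
    using assms(1) by (simp add: atLeast0LessThan)
  have tr: "column_minor b ls = Determinant.det (Matrix.mat ?m ?m (\<lambda>(i, j). (b ! j) $ (ls ! i)))" for ls
    unfolding column_minor_def
    by (subst Determinant.det_transpose[of _ ?m, symmetric])
       (auto intro!: arg_cong[of _ _ Determinant.det] eq_matI)
  have "column_minor b (permute_list p ks) =
      Determinant.det (Matrix.mat ?m ?m (\<lambda>(i, j). ?A $$ (p i, j)))"
    unfolding tr using p assms
    by (intro arg_cong[of _ _ Determinant.det] eq_matI)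
       (auto simp: permute_list_nth permutes_nat_less)
  also have "\<dots> = signof p * Determinant.det ?A"
    by (rule det_permute_rows[OF _ p]) simp
  finally show ?thesis
    by (simp add: tr)
qed

text \<open>
  The sign relating the order \<open>J, k\<close> of the columns to the increasing one.  It is chosen through some
  sorting permutation, not computed: only that it is nonzero and depends on \<open>J\<close> and \<open>k\<close> alone matters,
  so that it is the same for all subspaces.
\<close>

definition insertion_sign :: "'n::{finite,linorder} set \<Rightarrow> 'n \<Rightarrow> 'a::field" where
  "insertion_sign J k = signof (SOME p. p permutes {..<Suc (card J)} \<and>
     permute_list p (sorted_list_of_set (insert k J)) = sorted_list_of_set J @ [k])"

lemma insertion_sign_nonzero: "insertion_sign J k \<noteq> (0 :: 'a::field)"
  by (simp add: insertion_sign_def sign_def)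

lemma column_minor_append:
  fixes b :: "('a::field ^ 'n::{finite,linorder}) list"
  assumes "length b = Suc (card J)" "k \<notin> J"
  shows "column_minor b (sorted_list_of_set J @ [k]) = insertion_sign J k * maximal_minor b (insert k J)"
proof -
  let ?ks = "sorted_list_of_set (insert k J)"
  have len: "length ?ks = Suc (card J)"
    using assms(2) by simp
  have "mset (sorted_list_of_set J @ [k]) = mset ?ks"
    using assms(2) by simp
  then have "\<exists>p. p permutes {..<Suc (card J)} \<and> permute_list p ?ks = sorted_list_of_set J @ [k]"
    using mset_eq_permutation[of "sorted_list_of_set J @ [k]" ?ks] unfolding len by metis
  moreover define p where "p = (SOME p. p permutes {..<Suc (card J)} \<and>
    permute_list p ?ks = sorted_list_of_set J @ [k])"
  ultimately have p: "p permutes {..<length b}" "permute_list p ?ks = sorted_list_of_set J @ [k]"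
    using someI_ex[of "\<lambda>p. p permutes {..<Suc (card J)} \<and>
      permute_list p ?ks = sorted_list_of_set J @ [k]"] assms(1) by (simp_all only:)
  have "insertion_sign J k = (signof p :: 'a)"
    by (simp only: insertion_sign_def p_def)
  then show ?thesis
    using column_minor_permute[OF p(1), of ?ks] len assms(1)
    by (simp only: p(2) maximal_minor_eq_column_minor)
qed

section \<open>Bordered minors\<close>

text \<open>
  The columns \<open>J\<close> of the matrix with rows \<open>b\<close>, bordered by the column of values of a functional \<open>\<phi>\<close>
  on the rows; it is meant for \<open>J\<close> with one element less than \<open>b\<close> has entries.  If \<open>\<phi>\<close> is nonzero on the
  span of \<open>b\<close>, then as a function of \<open>J\<close> this is the Pluecker vector of the kernel of \<open>\<phi>\<close> there, up to a scalar
  (lemma \<open>bordered_minor_append\<close>), while linearity in the last column makes it a contraction of the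
  Pluecker vector of the whole span (lemma \<open>bordered_minor_expansion\<close>).
\<close>

definition bordered_minor ::
    "('a::field ^ 'n::{finite,linorder}) list \<Rightarrow> 'n set \<Rightarrow> 'a ^ 'n::{finite,linorder} \<Rightarrow> 'a" where
  "bordered_minor b J \<phi> =
     Determinant.det (Matrix.mat (length b) (length b)
       (\<lambda>(i, j). if Suc j < length b then (b ! i) $ (sorted_list_of_set J ! j) else pairing \<phi> (b ! i)))"

lemma bordered_minor_row_combination:
  assumes "length c = length b" "\<And>i. i < length b \<Longrightarrow> c ! i = (\<Sum>l<length b. G i l *s b ! l)"
  shows "bordered_minor c J \<phi> =
    Determinant.det (Matrix.mat (length b) (length b) (\<lambda>(i, j). G i j)) * bordered_minor b J \<phi>"
proof -
  have "pairing \<phi> (\<Sum>l<length b. G i l *s b ! l) = (\<Sum>l<length b. G i l * pairing \<phi> (b ! l))" for i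
    by (simp add: sum_distrib_left mult.left_commute) (rule sum.swap)
  then show ?thesis
    unfolding bordered_minor_def assms(1)
    by (intro det_row_combination) (simp add: assms(2))
qed

text \<open>
  The cofactors along the last column do not involve that column, so the determinant is linear in it;
  and the column of values of \<open>\<phi>\<close> is the combination of the columns of \<open>b\<close> with coefficients
  \<open>\<phi> $ k\<close>.
\<close>

lemma bordered_minor_expansion:
  fixes b :: "('a::field ^ 'n::{finite,linorder}) list"
  assumes "length b = Suc d" "card J = d"
  shows "bordered_minor b J \<phi> = (\<Sum>k\<in>UNIV. \<phi> $ k * column_minor b (sorted_list_of_set J @ [k]))"
proof -
  define A where "A w = Matrix.mat (Suc d) (Suc d)
    (\<lambda>(i, j). if j < d then (b ! i) $ (sorted_list_of_set J ! j) else w (b ! i))" for w :: "'a ^ 'n::{finite,linorder} \<Rightarrow> 'a"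
  have len: "length (sorted_list_of_set J) = d"
    using assms by simp
  have cof: "cofactor (A w) i d = cofactor (A (\<lambda>_. 0)) i d" if "i < Suc d" for w i
    using that unfolding cofactor_def A_def
    by (intro arg_cong2[of _ _ _ _ "(*)"] refl arg_cong[of _ _ Determinant.det])
       (auto simp: mat_delete_def intro!: eq_matI)
  have exp: "Determinant.det (A w) = (\<Sum>i<Suc d. w (b ! i) * cofactor (A (\<lambda>_. 0)) i d)" for w
  proof -
    have "Determinant.det (A w) = (\<Sum>i<Suc d. A w $$ (i, d) * cofactor (A w) i d)"
      by (rule laplace_expansion_column) (simp_all add: A_def)
    also have "\<dots> = (\<Sum>i<Suc d. w (b ! i) * cofactor (A (\<lambda>_. 0)) i d)"
      by (intro sum.cong refl arg_cong2[of _ _ _ _ "(*)"] cof) (auto simp: A_def)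
    finally show ?thesis .
  qed
  have col: "column_minor b (sorted_list_of_set J @ [k]) = Determinant.det (A (\<lambda>v. v $ k))" for k
    unfolding column_minor_def A_def assms(1)
    by (intro arg_cong[of _ _ Determinant.det] eq_matI) (auto simp: nth_append len assms(2))
  have "bordered_minor b J \<phi> = Determinant.det (A (pairing \<phi>))"
    unfolding bordered_minor_def A_def assms(1)
    by (intro arg_cong[of _ _ Determinant.det] eq_matI) (auto)
  also have "\<dots> = (\<Sum>k\<in>UNIV. \<phi> $ k * Determinant.det (A (\<lambda>v. v $ k)))"
    unfolding exp sum_distrib_right sum_distrib_left
    by (subst sum.swap) (simp add: mult.assoc)
  finally show ?thesis
    by (simp add: col)
qed

text \<open>
  If \<open>\<phi>\<close> vanishes on all rows but the last, the bordering column has a single nonzero entry, in the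
  corner.
\<close>

lemma bordered_minor_append:
  fixes y :: "('a::field ^ 'n::{finite,linorder}) list"
  assumes "\<And>v. v \<in> set y \<Longrightarrow> pairing \<phi> v = 0"
  shows "bordered_minor (y @ [z]) J \<phi> = pairing \<phi> z * maximal_minor y J"
proof -
  define d where "d = length y"
  define A where "A = Matrix.mat (Suc d) (Suc d)
    (\<lambda>(i, j). if j < d then ((y @ [z]) ! i) $ (sorted_list_of_set J ! j) else pairing \<phi> ((y @ [z]) ! i))"
  have "bordered_minor (y @ [z]) J \<phi> = Determinant.det A"
    unfolding bordered_minor_def A_def d_def by simp
  also have "\<dots> = (\<Sum>i<Suc d. A $$ (i, d) * cofactor A i d)"
    by (rule laplace_expansion_column) (simp_all add: A_def)
  also have "\<dots> = A $$ (d, d) * cofactor A d d"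
    by (simp add: A_def nth_append d_def assms)
  also have "cofactor A d d = Determinant.det (mat_delete A d d)"
    by (simp add: cofactor_def flip: mult_2)
  also have "mat_delete A d d = Matrix.mat d d (\<lambda>(i, j). (y ! i) $ (sorted_list_of_set J ! j))"
    by (rule eq_matI) (auto simp: mat_delete_def A_def nth_append d_def)
  finally show ?thesis
    by (simp add: maximal_minor_def d_def A_def nth_append)
qed

section \<open>The Pluecker cone of the hyperplanes of a subspace\<close>

text \<open>
  The contraction of a \<open>d + 1\<close>-vector \<open>q\<close> by a functional \<open>\<phi>\<close>, in coordinates.  The vectors
  \<open>contraction_column q J\<close> are the columns of the matrix whose rows are the contractions of \<open>q\<close> by
  the coordinate functionals, and these rows span the space of all contractions.
\<close>

definition contraction_column :: "'a::field ^ ('n::{finite,linorder} set) \<Rightarrow> 'n set \<Rightarrow> 'n \<Rightarrow> 'a" where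
  "contraction_column q J k = (if k \<in> J then 0 else insertion_sign J k * q $ (insert k J))"

definition contraction ::
    "nat \<Rightarrow> 'a::field ^ ('n::{finite,linorder} set) \<Rightarrow> 'a ^ 'n::{finite,linorder} \<Rightarrow> 'a ^ ('n set)" where
  "contraction d q \<phi> =
     (\<chi> J. if card J = d then \<Sum>k\<in>UNIV. \<phi> $ k * contraction_column q J k else 0)"

lemma bordered_minor_eq_contraction:
  fixes b :: "('a::field ^ 'n::{finite,linorder}) list"
  assumes "length b = Suc d" "card J = d"
    and "q = (\<chi> I. if card I = Suc d then maximal_minor b I else 0)"
  shows "bordered_minor b J \<phi> = contraction d q \<phi> $ J"
proof -
  have "column_minor b (sorted_list_of_set J @ [k]) = contraction_column q J k" for k
  proof (cases "k \<in> J")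
    case True
    then show ?thesis
      using assms(1,2) by (subst column_minor_repeated) (simp_all add: contraction_column_def)
  next
    case False
    then show ?thesis
      using assms(1,2) by (subst column_minor_append) (simp_all add: contraction_column_def assms(3))
  qed
  then show ?thesis
    using assms(2) by (simp add: contraction_def bordered_minor_expansion[OF assms(1,2)])
qed

lemma contraction_scale: "contraction d q (r *s \<phi>) = r *s contraction d q \<phi>"
  by (simp add: contraction_def Finite_Cartesian_Product.vec_eq_iff sum_distrib_left mult.assoc)

lemma contraction_add: "contraction d q (\<phi> + \<psi>) = contraction d q \<phi> + contraction d q \<psi>"
  by (simp add: contraction_def Finite_Cartesian_Product.vec_eq_iff distrib_right sum.distrib)

lemma subspace_range_contraction:
  fixes q :: "'a::field ^ ('n::{finite,linorder} set)"
  shows "vec.subspace (range (contraction d q))"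
proof (rule vec.subspaceI)
  have "contraction d q 0 = 0"
    using contraction_scale[of d q 0 0] by simp
  then show "0 \<in> range (contraction d q)"
    by (intro range_eqI) (rule sym)
next
  fix v w assume "v \<in> range (contraction d q)" "w \<in> range (contraction d q)"
  then obtain \<phi> \<psi> where "v = contraction d q \<phi>" "w = contraction d q \<psi>"
    by blast
  then have "v + w = contraction d q (\<phi> + \<psi>)"
    by (simp add: contraction_add)
  then show "v + w \<in> range (contraction d q)"
    by (rule range_eqI)
next
  fix r v assume "v \<in> range (contraction d q)"
  then obtain \<phi> where "v = contraction d q \<phi>"
    by blast
  then have "r *s v = contraction d q (r *s \<phi>)"
    by (simp add: contraction_scale)
  then show "r *s v \<in> range (contraction d q)"
    by (rule range_eqI)
qed

lemma is_pluecker_vector_iff: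
  assumes "vec.dim Y = k"
  shows "is_pluecker_vector k Y p \<longleftrightarrow>
    (\<exists>b. length b = k \<and> vec.span (set b) = Y \<and>
      p = (\<chi> I. if card I = k then maximal_minor b I else 0))"
proof -
  have "distinct b \<and> vec.independent (set b)" if "length b = k" "vec.span (set b) = Y" for b
    using vec_basis_list[OF that(2)] that(1) assms by simp
  then show ?thesis
    unfolding is_pluecker_vector_def by blast
qed

text \<open>
  The scalar is absorbed into the first basis vector, which exists as \<open>k \<ge> 1\<close>; the zero subspace has
  only one Pluecker vector.
\<close>

lemma is_pluecker_vector_scale:
  fixes p :: "'a::field ^ ('n::{finite,linorder} set)"
  assumes "is_pluecker_vector k Y p" "vec.dim Y = k" "k \<ge> 1" "r \<noteq> 0"
  shows "is_pluecker_vector k Y (r *s p)"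
proof -
  obtain b where b: "length b = k" "vec.span (set b) = Y"
    "p = (\<chi> I. if card I = k then maximal_minor b I else 0)"
    using assms(1,2) is_pluecker_vector_iff by blast
  obtain v bs where v: "b = v # bs"
    using b(1) assms(3) by (cases b) auto
  have "maximal_minor ((r *s v) # bs) I = r * maximal_minor b I" for I
  proof -
    let ?A = "Matrix.mat k k (\<lambda>(i, j). (b ! i) $ (sorted_list_of_set I ! j))"
    have "maximal_minor ((r *s v) # bs) I = Determinant.det (multrow 0 r ?A)"
      unfolding maximal_minor_def using b(1) v
      by (intro arg_cong[of _ _ Determinant.det] eq_matI) (auto simp: nth_Cons')
    also have "\<dots> = r * Determinant.det ?A"
      using assms(3) by (intro det_multrow[of 0 k]) auto
    finally show ?thesis
      by (simp add: maximal_minor_def b(1))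
  qed
  then have "r *s p = (\<chi> I. if card I = k then maximal_minor ((r *s v) # bs) I else 0)"
    by (simp add: b(3) Finite_Cartesian_Product.vec_eq_iff)
  moreover have "vec.span (set ((r *s v) # bs)) = Y"
  proof -
    have "v = (1 / r) *s (r *s v)"
      using assms(4) by simp
    then have "v \<in> vec.span (set ((r *s v) # bs))"
      by (metis list.set_intros(1) vec.span_base vec.span_scale)
    then have "set b \<subseteq> vec.span (set ((r *s v) # bs))"
      by (auto simp: v intro: vec.span_base)
    moreover have "set ((r *s v) # bs) \<subseteq> vec.span (set b)"
      by (auto simp: v intro: vec.span_base vec.span_scale)
    ultimately show ?thesis
      using b(2) by (metis vec.span_minimal vec.subspace_span subset_antisym)
  qed
  ultimately show ?thesis
    using is_pluecker_vector_iff[OF assms(2)] b(1) v by (metis length_Cons)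
qed

text \<open>
  The hyperplanes of \<open>X\<close> are the kernels of nonzero functionals on \<open>X\<close>, and passing to the kernel of
  \<open>\<phi>\<close> contracts the Pluecker vector by \<open>\<phi>\<close>.  To see this, compare a basis \<open>b\<close> of \<open>X\<close> with a basis
  \<open>y @ [z]\<close> adapted to the hyperplane: bordered minors change by a determinant only, and for the
  adapted basis they are multiples of the minors of \<open>y\<close>.  In particular the cone is a linear space.
\<close>

lemma pluecker_cone_hyperplanes:
  fixes X :: "('a::field ^ 'n::{finite,linorder}) set"
  assumes "vec.subspace X" "vec.dim X = Suc d" "d \<ge> 1" "is_pluecker_vector (Suc d) X q"
  shows "pluecker_cone d (L d X) = range (contraction d q)"
proof -
  obtain b where b: "length b = Suc d" "vec.span (set b) = X"
    and q: "q = (\<chi> I. if card I = Suc d then maximal_minor b I else 0)"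
    using assms(4) is_pluecker_vector_iff[OF assms(2)] by blast
  have zero: "contraction d q 0 = 0"
    using contraction_scale[of d q 0 0] by simp
  have "p \<in> range (contraction d q)"
    if Y: "Y \<subseteq> X" "vec.dim Y = d" and p: "is_pluecker_vector d Y p" for Y p
  proof -
    obtain y where y: "length y = d" "distinct y" "vec.independent (set y)" "vec.span (set y) = Y"
      and p_eq: "p = (\<chi> J. if card J = d then maximal_minor y J else 0)"
      using p unfolding is_pluecker_vector_def by blast
    have "set y \<subseteq> X"
      using y(4) Y(1) vec.span_superset by blast
    then obtain z where z: "z \<notin> vec.span (set y)" "vec.span (set (y @ [z])) = X"
      using vec_extend_basis_list[OF assms(1), of y] assms(2) y by auto
    obtain \<phi> where \<phi>: "\<forall>v\<in>set y. pairing \<phi> v = 0" "pairing \<phi> z = 1"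
      using vec_separating_functional[OF y(3) z(1)] by blast
    \<comment> \<open>The determinant by which the two bases differ will be absorbed into \<open>\<phi>\<close>.\<close>
    have "set (y @ [z]) \<subseteq> vec.span (set b)"
      using z(2) b(2) vec.span_superset by blast
    then obtain G where "\<forall>i<length (y @ [z]). (y @ [z]) ! i = (\<Sum>l<length b. G i l *s b ! l)"
      using vec_span_list_rows by blast
    then have G: "bordered_minor (y @ [z]) J \<phi> =
        Determinant.det (Matrix.mat (length b) (length b) (\<lambda>(i, j). G i j)) * bordered_minor b J \<phi>" for J
      using y(1) b(1) by (intro bordered_minor_row_combination) auto
    let ?r = "Determinant.det (Matrix.mat (length b) (length b) (\<lambda>(i, j). G i j))"
    have "p $ J = contraction d q (?r *s \<phi>) $ J" for J
    proof (cases "card J = d")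
      case True
      have "p $ J = bordered_minor (y @ [z]) J \<phi>"
        using True \<phi> by (subst bordered_minor_append) (auto simp: p_eq)
      then show ?thesis
        using bordered_minor_eq_contraction[OF b(1) True q, of \<phi>] by (simp add: G contraction_scale)
    next
      case False
      then show ?thesis
        by (simp add: p_eq contraction_def)
    qed
    then have "p = contraction d q (?r *s \<phi>)"
      by (simp add: Finite_Cartesian_Product.vec_eq_iff)
    then show ?thesis
      by blast
  qed
  moreover have "contraction d q \<phi> = 0 \<or>
      (\<exists>Y. vec.subspace Y \<and> vec.dim Y = d \<and> Y \<subseteq> X \<and> is_pluecker_vector d Y (contraction d q \<phi>))" for \<phi>
  proof -
    let ?W = "X \<inter> {v. pairing \<phi> v = 0}"
    \<comment> \<open>If \<open>\<phi>\<close> vanishes on \<open>X\<close>, then \<open>?W\<close> is all of \<open>X\<close>; any \<open>d\<close>-dimensional \<open>Y\<close> in it will do,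
      since then \<open>pairing \<phi> z\<close> and the contraction are zero.\<close>
    obtain B where B: "B \<subseteq> ?W" "vec.independent B" "?W \<subseteq> vec.span B" "card B = vec.dim ?W"
      by (rule vec.basis_exists)
    have "d \<le> card B"
      using vec_dim_kernel[OF assms(1,2)] B(4) by simp
    then obtain B' where B': "B' \<subseteq> B" "card B' = d" "finite B'"
      by (rule obtain_subset_with_card_n)
    then obtain y where y: "set y = B'" "distinct y" "length y = d"
      using finite_distinct_list[OF B'(3)] distinct_card by metis
    have ind: "vec.independent (set y)"
      using B(2) B'(1) y(1) vec.independent_mono by blast
    define Y where "Y = vec.span (set y)"
    have Y: "vec.subspace Y" "vec.dim Y = d" "Y \<subseteq> X"
    proof -
      show "vec.subspace Y" "vec.dim Y = d"
        using ind y B'(2) by (simp_all add: Y_def vec.dim_eq_card_independent distinct_card)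
      show "Y \<subseteq> X"
        unfolding Y_def using assms(1) y(1) B'(1) B(1) by (intro vec.span_minimal) auto
    qed
    have "set y \<subseteq> X"
      using Y(3) vec.span_superset Y_def by blast
    then obtain z where z: "vec.span (set (y @ [z])) = X"
      using vec_extend_basis_list[OF assms(1), of y] assms(2) y ind by auto
    have "set b \<subseteq> vec.span (set (y @ [z]))"
      using z b(2) vec.span_superset by blast
    then obtain G where "\<forall>i<length b. b ! i = (\<Sum>l<length (y @ [z]). G i l *s (y @ [z]) ! l)"
      using vec_span_list_rows by blast
    then have G: "bordered_minor b J \<phi> =
        Determinant.det (Matrix.mat (Suc d) (Suc d) (\<lambda>(i, j). G i j)) * bordered_minor (y @ [z]) J \<phi>" for J
      using y(3) b(1) bordered_minor_row_combination[of b "y @ [z]" G] by auto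
    define r where "r = Determinant.det (Matrix.mat (Suc d) (Suc d) (\<lambda>(i, j). G i j)) * pairing \<phi> z"
    define p :: "'a ^ ('n set)" where "p = (\<chi> J. if card J = d then maximal_minor y J else 0)"
    have "is_pluecker_vector d Y p"
      unfolding is_pluecker_vector_def p_def using y ind Y_def by blast
    moreover have "contraction d q \<phi> = r *s p"
    proof -
      have "contraction d q \<phi> $ J = r * p $ J" for J
      proof (cases "card J = d")
        case True
        have "bordered_minor (y @ [z]) J \<phi> = pairing \<phi> z * maximal_minor y J"
          using y(1) B'(1) B(1) by (intro bordered_minor_append) auto
        then show ?thesis
          using bordered_minor_eq_contraction[OF b(1) True q, of \<phi>] True by (simp add: G r_def p_def mult.assoc)
      next
        case False
        then show ?thesis
          by (simp add: p_def contraction_def)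
      qed
      then show ?thesis
        by (simp add: Finite_Cartesian_Product.vec_eq_iff)
    qed
    ultimately show ?thesis
      using is_pluecker_vector_scale[of d Y p r] Y assms(3) by (cases "r = 0") auto
  qed
  ultimately show ?thesis
    unfolding pluecker_cone_def LS_empty Gr_def
  proof (intro equalityI subsetI, goal_cases)
    case (1 p)
    then show ?case
      using zero by (auto intro: range_eqI[of _ _ 0])
  next
    case (2 p)
    then show ?case
      by blast
  qed
qed

section \<open>The Pluecker vector of the preimage of a subspace under a projection\<close>

text \<open>
  As the minor in the columns \<open>C\<close> is nonzero, multiplying with the inverse of that square block gives
  a basis whose block in the columns \<open>C\<close> is the identity.
\<close>

lemma vec_normal_basis:
  fixes X :: "('a::field ^ 'n::{finite,linorder}) set"
  assumes "vec.subspace X" "vec.dim X = m" "is_pluecker_vector m X q" "card C = m" "q $ C \<noteq> 0"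
  shows "\<exists>x r. length x = m \<and> vec.span (set x) = X \<and> r \<noteq> 0 \<and>
    (\<forall>I. card I = m \<longrightarrow> maximal_minor x I = r * q $ I) \<and>
    (\<forall>i<m. \<forall>j<m. (x ! i) $ (sorted_list_of_set C ! j) = (if i = j then 1 else 0))"
proof -
  obtain b where b: "length b = m" "vec.span (set b) = X"
    and q: "q = (\<chi> I. if card I = m then maximal_minor b I else 0)"
    using assms(3) is_pluecker_vector_iff[OF assms(2)] by blast
  define A where "A = Matrix.mat m m (\<lambda>(i, j). (b ! i) $ (sorted_list_of_set C ! j))"
  have A: "A \<in> carrier_mat m m"
    by (simp add: A_def)
  have "Determinant.det A \<noteq> 0"
    using assms(4,5) b(1) by (simp add: q maximal_minor_def A_def)
  then obtain H where H: "H \<in> carrier_mat m m" "H * A = 1\<^sub>m m"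
    using det_non_zero_imp_unit[OF A, of "()"] by (auto simp: Units_def ring_mat_def)
  then have det: "Determinant.det H \<noteq> 0"
    using Determinant.det_mult[OF H(1) A] by auto
  define x where "x = map (\<lambda>i. \<Sum>l<m. H $$ (i, l) *s b ! l) [0..<m]"
  have len: "length x = m" and nth: "\<And>i. i < m \<Longrightarrow> x ! i = (\<Sum>l<m. H $$ (i, l) *s b ! l)"
    by (simp_all add: x_def)
  have dual: "(x ! i) $ (sorted_list_of_set C ! j) = (if i = j then 1 else 0)"
    if "i < m" "j < m" for i j
  proof -
    have "(x ! i) $ (sorted_list_of_set C ! j) = (H * A) $$ (i, j)"
      using that H(1) A
      by (simp add: nth scalar_prod_def atLeast0LessThan A_def)
    then show ?thesis
      using that H(2) by simp
  qed
  have "distinct x" "vec.independent (set x)"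
    using vec_dual_coordinates_independent[of x "sorted_list_of_set C"] dual len by auto
  have sub: "set x \<subseteq> X"
    using b assms(1) unfolding x_def
    by (auto intro!: vec.subspace_sum vec.subspace_scale intro: vec.span_base)
  have "vec.span (set x) = X"
  proof (rule vec.subspace_dim_equal)
    show "vec.span (set x) \<subseteq> X"
      using sub assms(1) by (rule vec.span_minimal)
    show "vec.dim X \<le> vec.dim (vec.span (set x))"
      using \<open>distinct x\<close> \<open>vec.independent (set x)\<close> assms(2) len
      by (simp add: vec.dim_eq_card_independent distinct_card)
  qed (simp_all add: assms(1))
  moreover have "maximal_minor x I = Determinant.det H * q $ I" if "card I = m" for I
  proof -
    have "Matrix.mat m m (\<lambda>(i, j). H $$ (i, j)) = H"
      using H(1) by (intro eq_matI) auto
    then show ?thesis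
      using column_minor_row_combination[of x b "\<lambda>i l. H $$ (i, l)" "sorted_list_of_set I"] len nth b(1) that
      by (simp add: q maximal_minor_eq_column_minor)
  qed
  ultimately show ?thesis
    using len det dual by blast
qed

text \<open>
  Replacing the rows of such a normalised basis that belong to \<open>S\<close> by unit vectors does not change
  the minors in columns \<open>I\<close> containing \<open>S\<close>.  In the Leibniz formula, a permutation that matches each of these rows
  to its own column contributes the same product in both cases.  Any other
  permutation contributes zero on both sides.  It matches the row of some \<open>a \<in> S\<close> to a column other
  than \<open>a\<close>, where the unit row of \<open>y\<close> is zero; and it matches column \<open>a\<close> to another row, where \<open>x\<close> is
  zero.  If \<open>I\<close> misses an element of \<open>S\<close>, the corresponding unit
  row vanishes on \<open>I\<close>.
\<close>

lemma maximal_minor_unit_rows: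
  fixes x y :: "('a::field ^ 'n::{finite,linorder}) list"
  assumes len: "length x = m" "length y = m" "card C = m" "card I = m" and "S \<subseteq> C"
    and dual: "\<And>i j. i < m \<Longrightarrow> j < m \<Longrightarrow>
      (x ! i) $ (sorted_list_of_set C ! j) = (if i = j then 1 else 0)"
    and y: "\<And>i. i < m \<Longrightarrow> y ! i =
      (if sorted_list_of_set C ! i \<in> S then axis (sorted_list_of_set C ! i) 1 else x ! i)"
  shows "maximal_minor y I = (if S \<subseteq> I then maximal_minor x I else 0)"
proof -
  define cs where "cs = sorted_list_of_set C"
  define ks where "ks = sorted_list_of_set I"
  have sets: "set cs = C" "length cs = m" "set ks = I" "length ks = m"
    using len by (simp_all add: cs_def ks_def)
  have minor: "maximal_minor w I =
      (\<Sum>p | p permutes {0..<m}. signof p * (\<Prod>i = 0..<m. (w ! i) $ (ks ! p i)))"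
    if "length w = m" for w :: "('a ^ 'n::{finite,linorder}) list"
    unfolding maximal_minor_def that ks_def
    by (subst det_def'[of _ m]) (auto intro!: sum.cong prod.cong simp: permutes_nat_less)
  have "(\<Prod>i = 0..<m. (y ! i) $ (ks ! p i)) =
      (if S \<subseteq> I then \<Prod>i = 0..<m. (x ! i) $ (ks ! p i) else 0)"
    if p: "p permutes {0..<m}" for p
  proof (cases "S \<subseteq> I \<and> (\<forall>i<m. cs ! i \<in> S \<longrightarrow> ks ! p i = cs ! i)")
    case True
    have "(y ! i) $ (ks ! p i) = (x ! i) $ (ks ! p i)" if "i < m" for i
      using True that y[OF that] dual[OF that that] by (auto simp: cs_def axis_def)
    then show ?thesis
      using True by simp
  next
    case False
    have "\<exists>i<m. cs ! i \<in> S \<and> ks ! p i \<noteq> cs ! i"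
    proof (cases "S \<subseteq> I")
      case notsub: False
      then obtain a where "a \<in> S" "a \<notin> I"
        by blast
      moreover obtain i where "i < m" "cs ! i = a"
        using \<open>a \<in> S\<close> assms(5) sets by (metis in_set_conv_nth subsetD)
      moreover have "ks ! p i \<in> I"
        using permutes_nat_less[OF p \<open>i < m\<close>] sets by (metis nth_mem)
      ultimately show ?thesis
        by metis
    qed (use False in blast)
    then obtain i where i: "i < m" "cs ! i \<in> S" "ks ! p i \<noteq> cs ! i"
      by blast
    then have "(y ! i) $ (ks ! p i) = 0"
      using y[OF i(1)] by (simp add: cs_def axis_def)
    then have y0: "(\<Prod>i = 0..<m. (y ! i) $ (ks ! p i)) = 0"
      using i(1) by (intro prod_zero) auto
    have x0: "(\<Prod>i = 0..<m. (x ! i) $ (ks ! p i)) = 0" if "S \<subseteq> I"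
    proof -
      have "cs ! i \<in> set ks"
        using i(2) that sets by blast
      then obtain j where j: "j < m" "ks ! j = cs ! i"
        using sets(4) by (auto simp: in_set_conv_nth)
      obtain l where l: "l < m" "p l = j"
        using j(1) permutes_image[OF p] by (metis atLeast0LessThan imageE lessThan_iff)
      have "l \<noteq> i"
        using i(3) j(2) l(2) by metis
      then have "(x ! l) $ (ks ! p l) = 0"
        using dual[OF l(1) i(1)] l j by (simp add: cs_def)
      then show ?thesis
        using l(1) by (intro prod_zero) auto
    qed
    show ?thesis
      by (cases "S \<subseteq> I") (simp_all only: y0 x0 if_True if_False)
  qed
  then show ?thesis
    by (auto simp: minor[OF len(1)] minor[OF len(2)] intro!: sum.cong sum.neutral)
qed

lemma vec_subspace_pr_vimage:
  fixes X :: "('a::field ^ 'n::finite) set"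
  assumes "vec.subspace X"
  shows "vec.subspace {v. pr S v \<in> X}"
proof (rule vec.subspaceI)
  have [simp]: "pr S (v + w) = pr S v + pr S w" "pr S 0 = 0" "pr S (r *s v) = r *s pr S v"
    for v w :: "'a ^ 'n" and r
    by (simp_all add: pr_def Finite_Cartesian_Product.vec_eq_iff)
  show "0 \<in> {v. pr S v \<in> X}"
    using assms by (simp add: vec.subspace_0)
  show "v + w \<in> {v. pr S v \<in> X}" if "v \<in> {v. pr S v \<in> X}" "w \<in> {v. pr S v \<in> X}" for v w
    using that assms by (simp add: vec.subspace_add)
  show "r *s v \<in> {v. pr S v \<in> X}" if "v \<in> {v. pr S v \<in> X}" for r v
    using that assms by (simp add: vec.subspace_scale)
qed

text \<open>
  The preimage is the direct sum of \<open>{x \<in> X. x vanishes on S}\<close> and the coordinate subspace of \<open>S\<close>.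
  In a basis \<open>x\<close> of \<open>X\<close> normalised at \<open>C\<close>, the vectors belonging to \<open>C - S\<close> form a basis of the first
  summand, so replacing the other ones by unit vectors gives a basis of the preimage.
\<close>

lemma pluecker_vector_pr_vimage:
  fixes X :: "('a::field ^ 'n::{finite,linorder}) set"
  assumes "vec.subspace X" "vec.dim X = m" "is_pluecker_vector m X q"
    and "card C = m" "S \<subseteq> C" "q $ C \<noteq> 0"
  shows "vec.dim {v. pr S v \<in> X} = m" (is ?dim)
    and "\<exists>r. r \<noteq> 0 \<and> is_pluecker_vector m {v. pr S v \<in> X} (\<chi> I. if S \<subseteq> I then r * q $ I else 0)"
      (is ?pluecker)
proof -
  let ?X' = "{v. pr S v \<in> X}"
  define cs where "cs = sorted_list_of_set C"
  have sets: "set cs = C" "length cs = m" "distinct cs"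
    using assms(4) by (simp_all add: cs_def)
  have index: "\<exists>j<m. cs ! j = a" if "a \<in> S" for a
  proof -
    have "a \<in> set cs"
      using that assms(5) sets(1) by blast
    then show ?thesis
      by (auto simp: in_set_conv_nth sets(2))
  qed
  obtain x r where x: "length x = m" "vec.span (set x) = X" "r \<noteq> 0"
    and minor: "\<And>I. card I = m \<Longrightarrow> maximal_minor x I = r * q $ I"
    and dual: "\<And>i j. i < m \<Longrightarrow> j < m \<Longrightarrow> (x ! i) $ (cs ! j) = (if i = j then 1 else 0)"
    using vec_normal_basis[OF assms(1-4,6)] unfolding cs_def by blast
  define y where "y = map (\<lambda>i. if cs ! i \<in> S then axis (cs ! i) 1 else x ! i) [0..<m]"
  have y: "length y = m" "\<And>i. i < m \<Longrightarrow> y ! i = (if cs ! i \<in> S then axis (cs ! i) 1 else x ! i)"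
    by (simp_all add: y_def)
  have dual_y: "(y ! i) $ (cs ! j) = (if i = j then 1 else 0)" if "i < m" "j < m" for i j
    using that dual sets by (simp add: y axis_def nth_eq_iff_index_eq)
  note ind = vec_dual_coordinates_independent[of y cs, unfolded y(1), OF dual_y]
  have "vec.span (set y) = ?X'"
  proof
    have "y ! i \<in> ?X'" if "i < m" for i
    proof (cases "cs ! i \<in> S")
      case True
      then have "pr S (y ! i) = 0"
        using that by (auto simp: y pr_def axis_def Finite_Cartesian_Product.vec_eq_iff)
      then show ?thesis
        using assms(1) by (simp add: vec.subspace_0)
    next
      case False
      have "(x ! i) $ a = 0" if "a \<in> S" for a
      proof -
        obtain j where "j < m" "cs ! j = a"
          using index[OF \<open>a \<in> S\<close>] by blast
        moreover have "i \<noteq> j"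
          using False that \<open>cs ! j = a\<close> by blast
        ultimately show ?thesis
          using dual[OF \<open>i < m\<close>, of j] by simp
      qed
      then have "pr S (y ! i) = x ! i"
        using False that by (auto simp: y pr_def Finite_Cartesian_Product.vec_eq_iff)
      moreover have "x ! i \<in> X"
        using x(1,2) that vec.span_base[of "x ! i" "set x"] by simp
      ultimately show ?thesis
        by simp
    qed
    then show "vec.span (set y) \<subseteq> ?X'"
      using vec_subspace_pr_vimage[OF assms(1), of S] y(1)
      by (intro vec.span_minimal) (auto simp: in_set_conv_nth)
  next
    show "?X' \<subseteq> vec.span (set y)"
    proof
      fix v assume "v \<in> ?X'"
      then have "pr S v = (\<Sum>l<m. pr S v $ (cs ! l) *s x ! l)"
        using vec_dual_coordinates_expansion[of x cs "pr S v"] dual x by simp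
      also have "\<dots> \<in> vec.span (set y)"
      proof (rule vec.span_sum)
        fix l assume "l \<in> {..<m}"
        then have "pr S v $ (cs ! l) *s x ! l = pr S v $ (cs ! l) *s y ! l"
          by (simp add: y pr_def)
        moreover have "pr S v $ (cs ! l) *s y ! l \<in> vec.span (set y)"
          using \<open>l \<in> {..<m}\<close> y(1) by (simp add: vec.span_scale vec.span_base)
        ultimately show "pr S v $ (cs ! l) *s x ! l \<in> vec.span (set y)"
          by (simp only:)
      qed
      finally have "pr S v \<in> vec.span (set y)" .
      moreover have "(\<Sum>a\<in>S. v $ a *s axis a 1) \<in> vec.span (set y)"
      proof (intro vec.span_sum vec.span_scale vec.span_base)
        fix a assume "a \<in> S"
        then obtain i where "i < m" "cs ! i = a"
          using index by blast
        then have "y ! i = axis a 1"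
          using y(2) \<open>a \<in> S\<close> by simp
        then show "axis a 1 \<in> set y"
          using \<open>i < m\<close> y(1) by (metis nth_mem)
      qed
      moreover have "v = pr S v + (\<Sum>a\<in>S. v $ a *s axis a 1)"
        by (simp add: Finite_Cartesian_Product.vec_eq_iff pr_def axis_def if_distrib[where f = "\<lambda>x. _ * x"] cong: if_cong)
      ultimately show "v \<in> vec.span (set y)"
        by (metis vec.span_add)
    qed
  qed
  moreover from this show ?dim
    using ind y(1) by (metis vec.dim_span vec.dim_eq_card_independent distinct_card)
  moreover have "maximal_minor y I = (if S \<subseteq> I then r * q $ I else 0)" if "card I = m" for I
    using maximal_minor_unit_rows[of x m y C I S] x(1) y assms(4,5) that dual minor
    by (simp add: cs_def)
  moreover have "q $ I = 0" if "card I \<noteq> m" for I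
    using that assms(3) by (auto simp: is_pluecker_vector_def)
  ultimately have "is_pluecker_vector m ?X' (\<chi> I. if S \<subseteq> I then r * q $ I else 0)"
    using ind y(1) unfolding is_pluecker_vector_def
    by (intro exI[of _ y]) (auto simp: Finite_Cartesian_Product.vec_eq_iff)
  then show ?pluecker
    using x(3) by blast
qed

section \<open>Independence of the columns of a contraction\<close>

text \<open>
  Independence of an indexed family, not of the set of its members: equal columns at different
  indices are dependent.
\<close>

definition independent_family :: "('e \<Rightarrow> 'n \<Rightarrow> 'a::field) \<Rightarrow> 'e set \<Rightarrow> bool" where
  "independent_family w A \<longleftrightarrow> (\<forall>c. (\<forall>k. (\<Sum>e\<in>A. c e * w e k) = 0) \<longrightarrow> (\<forall>e\<in>A. c e = 0))"

lemma independent_familyD: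
  "independent_family w A \<Longrightarrow> (\<And>k. (\<Sum>e\<in>A. c e * w e k) = 0) \<Longrightarrow> e \<in> A \<Longrightarrow> c e = 0"
  unfolding independent_family_def by blast

lemma independent_family_subset:
  fixes w :: "'e::finite \<Rightarrow> 'n \<Rightarrow> 'a::field"
  assumes "independent_family w A" "B \<subseteq> A"
  shows "independent_family w B"
  unfolding independent_family_def
proof (intro allI impI ballI)
  fix c e assume c: "\<forall>k. (\<Sum>e\<in>B. c e * w e k) = 0" and "e \<in> B"
  have "(\<Sum>e\<in>A. (if e \<in> B then c e else 0) * w e k) = (\<Sum>e\<in>B. c e * w e k)" for k
    using assms(2) by (intro sum.mono_neutral_cong_right) auto
  then show "c e = 0"
    using independent_familyD[OF assms(1), of "\<lambda>e. if e \<in> B then c e else 0" e] c \<open>e \<in> B\<close> assms(2)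
    by auto
qed

lemma independent_family_scale:
  fixes r :: "'a::field"
  assumes "r \<noteq> 0" "\<And>e k. e \<in> A \<Longrightarrow> w' e k = r * w e k"
  shows "independent_family w' A \<longleftrightarrow> independent_family w A"
proof -
  have "(\<Sum>e\<in>A. c e * w' e k) = r * (\<Sum>e\<in>A. c e * w e k)" for c k
    using assms(2) by (simp add: sum_distrib_left mult.left_commute)
  then show ?thesis
    using assms(1) by (simp add: independent_family_def)
qed

lemma indep_linear_matroid_subspace:
  fixes V :: "('a::field ^ 'e::finite) set"
  assumes "vec.subspace V"
  shows "A \<in> indep (linear_matroid E V) \<longleftrightarrow>
    A \<subseteq> E \<and> (\<forall>c. (\<forall>v\<in>V. (\<Sum>e\<in>A. c e * v $ e) = 0) \<longrightarrow> (\<forall>e\<in>A. c e = 0))"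
proof -
  obtain B where B: "B \<subseteq> V" "vec.independent B" "V \<subseteq> vec.span B" "card B = vec.dim V"
    by (rule vec.basis_exists)
  obtain rs where "set rs = B"
    using finite_list vec.finiteI_independent[OF B(2)] by blast
  then have "vec.span (set rs) = V"
    using B(1,3) assms by (simp add: subset_antisym vec.span_minimal)
  then show ?thesis
    by (simp add: indep_linear_matroid columns_independent_iff_span)
qed

text \<open>
  A relation between the columns of a matrix may be tested on any set of rows that spans the row space;
  here these are the contractions by the coordinate functionals.
\<close>

lemma indep_linear_matroid_contraction:
  fixes q :: "'a::field ^ ('n::{finite,linorder} set)"
  shows "A \<in> indep (linear_matroid {J. card J = d} (range (contraction d q))) \<longleftrightarrow>
    (\<forall>J\<in>A. card J = d) \<and> independent_family (contraction_column q) A"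
proof -
  have "(\<forall>v\<in>range (contraction d q). (\<Sum>J\<in>A. c J * v $ J) = 0) \<longleftrightarrow>
      (\<forall>k. (\<Sum>J\<in>A. c J * contraction_column q J k) = 0)" (is "?L \<longleftrightarrow> ?R")
    if A: "\<forall>J\<in>A. card J = d" for c
  proof -
    have eq: "(\<Sum>J\<in>A. c J * contraction d q \<phi> $ J) =
        (\<Sum>k\<in>UNIV. \<phi> $ k * (\<Sum>J\<in>A. c J * contraction_column q J k))" for \<phi>
    proof -
      have "(\<Sum>J\<in>A. c J * contraction d q \<phi> $ J) =
          (\<Sum>J\<in>A. \<Sum>k\<in>UNIV. \<phi> $ k * (c J * contraction_column q J k))"
        using A by (intro sum.cong) (auto simp: contraction_def sum_distrib_left mult.left_commute)
      also have "\<dots> = (\<Sum>k\<in>UNIV. \<phi> $ k * (\<Sum>J\<in>A. c J * contraction_column q J k))"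
        by (subst sum.swap) (simp add: sum_distrib_left)
      finally show ?thesis .
    qed
    show ?thesis
    proof
      assume ?L
      show ?R
      proof
        fix k
        have "(\<Sum>J\<in>A. c J * contraction d q (axis k 1) $ J) = 0"
          using \<open>?L\<close> by blast
        then show "(\<Sum>J\<in>A. c J * contraction_column q J k) = 0"
          unfolding eq
          by (simp add: axis_def if_distrib[where f = "\<lambda>x. x * _"] cong: if_cong)
      qed
    next
      assume ?R
      then show ?L
        by (auto simp: eq)
    qed
  qed
  then show ?thesis
    unfolding indep_linear_matroid_subspace[OF subspace_range_contraction] independent_family_def
    by blast
qed

section \<open>The decomposition\<close>

text \<open>
  The column of \<open>q'\<close> at \<open>J\<close> involves only the entries \<open>q' $ (insert k J)\<close>, which vanish unless
  \<open>S - J \<subseteq> {k}\<close>.  Hence it is zero if \<open>J\<close> misses two elements of \<open>S\<close>; it is a multiple of the unit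
  vector at \<open>a\<close> if \<open>J\<close> misses only \<open>a\<close>; and if \<open>S \<subseteq> J\<close> it agrees, up to \<open>r\<close>, with the column of \<open>q\<close>
  and is supported outside \<open>S\<close>.  So the groups of columns live on disjoint sets of coordinates and
  independence can be tested in each group separately.
\<close>

lemma independent_family_decompose:
  fixes q q' :: "'a::field ^ ('n::{finite,linorder} set)"
  assumes "r \<noteq> 0" and q': "\<And>I. q' $ I = (if S \<subseteq> I then r * q $ I else 0)"
  shows "independent_family (contraction_column q') A \<longleftrightarrow>
    independent_family (contraction_column q) {J \<in> A. S \<subseteq> J} \<and>
    (\<forall>J\<in>A. \<not> 2 \<le> card (S - J)) \<and>
    (\<forall>a\<in>S. \<forall>J\<in>A. S - J = {a} \<longrightarrow> q $ (J \<union> {a}) \<noteq> 0 \<and> (\<forall>J'\<in>A. S - J' = {a} \<longrightarrow> J' = J))"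
    (is "?L \<longleftrightarrow> ?top \<and> ?zero \<and> ?one")
proof -
  let ?w' = "contraction_column q'"
  let ?w = "contraction_column q"
  have w'_zero: "?w' J k = 0" if "2 \<le> card (S - J)" for J k
  proof -
    have "\<not> S \<subseteq> insert k J"
    proof
      assume "S \<subseteq> insert k J"
      then have "S - J \<subseteq> {k}"
        by blast
      then have "card (S - J) \<le> 1"
        by (metis card.empty card.insert card_mono empty_iff finite.emptyI finite_insert One_nat_def)
      then show False
        using that by simp
    qed
    then show ?thesis
      by (simp add: contraction_column_def q')
  qed
  have w'_one: "?w' J k = (if k = a then insertion_sign J a * r * q $ (J \<union> {a}) else 0)"
    if "S - J = {a}" for J a k
  proof -
    have "a \<notin> J" "S \<subseteq> insert a J" "k \<noteq> a \<Longrightarrow> \<not> S \<subseteq> insert k J"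
      using that by blast+
    then show ?thesis
      by (simp add: contraction_column_def q' mult.assoc)
  qed
  have w'_top: "?w' J k = r * ?w J k" "k \<in> S \<Longrightarrow> ?w J k = 0" if "S \<subseteq> J" for J k
    using that by (auto simp: contraction_column_def q' mult.left_commute)
  have top_iff: "independent_family ?w' {J \<in> A. S \<subseteq> J} \<longleftrightarrow> ?top"
    using assms(1) w'_top(1) by (intro independent_family_scale[of r]) auto
  show ?thesis
  proof
    assume ind: ?L
    have ?top
      using independent_family_subset[OF ind] top_iff by auto
    moreover have ?zero
    proof (intro ballI notI)
      fix J assume "J \<in> A" "2 \<le> card (S - J)"
      then have "independent_family ?w' {J}"
        using independent_family_subset[OF ind, of "{J}"] by blast
      then show False
        using independent_familyD[of ?w' "{J}" "\<lambda>_. 1" J] w'_zero[OF \<open>2 \<le> card (S - J)\<close>] by simp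
    qed
    moreover have ?one
    proof (intro ballI impI conjI)
      fix a J assume "a \<in> S" "J \<in> A" and J: "S - J = {a}"
      have "independent_family ?w' {J}"
        using independent_family_subset[OF ind, of "{J}"] \<open>J \<in> A\<close> by blast
      then have "\<exists>k. ?w' J k \<noteq> 0"
        using independent_familyD[of ?w' "{J}" "\<lambda>_. 1" J] by auto
      then show nz: "q $ (J \<union> {a}) \<noteq> 0"
        by (auto simp: w'_one[OF J] split: if_splits)
      fix J' assume "J' \<in> A" and J': "S - J' = {a}"
      show "J' = J"
      proof (rule ccontr)
        assume "J' \<noteq> J"
        have "independent_family ?w' {J', J}"
          using independent_family_subset[OF ind, of "{J', J}"] \<open>J \<in> A\<close> \<open>J' \<in> A\<close> by blast
        \<comment> \<open>Both columns are multiples of the unit vector at \<open>a\<close>, so cross-multiplying their entries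
          gives a relation.\<close>
        then have "?w' J a = 0"
          using independent_familyD[of ?w' "{J', J}" "\<lambda>e. if e = J' then ?w' J a else - ?w' J' a" J']
            \<open>J' \<noteq> J\<close> w'_one[OF J] w'_one[OF J'] by auto
        then show False
          using nz assms(1) insertion_sign_nonzero[of J a, where 'a = 'a] by (simp add: w'_one[OF J])
      qed
    qed
    ultimately show "?top \<and> ?zero \<and> ?one"
      by blast
  next
    assume R: "?top \<and> ?zero \<and> ?one"
    have cases: "S \<subseteq> J \<or> (\<exists>a\<in>S. S - J = {a})" if "J \<in> A" for J
    proof -
      have "card (S - J) = 0 \<or> card (S - J) = 1"
        using R that by (metis less_2_cases linorder_not_le One_nat_def)
      then show ?thesis
        by (auto simp: card_1_singleton_iff)
    qed
    show ?L
      unfolding independent_family_def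
    proof (intro allI impI ballI)
      fix c J assume c: "\<forall>k. (\<Sum>J\<in>A. c J * ?w' J k) = 0" and "J \<in> A"
      have off_top: "?w' J k = 0" if "J \<in> A" "\<not> S \<subseteq> J" "k \<notin> S" for J k
      proof -
        obtain a where "a \<in> S" "S - J = {a}"
          using cases[OF \<open>J \<in> A\<close>] \<open>\<not> S \<subseteq> J\<close> by blast
        then show ?thesis
          using w'_one[of J a k] \<open>k \<notin> S\<close> by auto
      qed
      show "c J = 0"
      proof (cases "S \<subseteq> J")
        case True
        \<comment> \<open>Coordinates in \<open>S\<close> do not see the columns with \<open>S \<subseteq> J\<close>, the other coordinates see
          only these.\<close>
        have "(\<Sum>J | J \<in> A \<and> S \<subseteq> J. c J * ?w' J k) = 0" for k
        proof (cases "k \<in> S")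
          case True
          then show ?thesis
            by (intro sum.neutral) (auto simp: w'_top)
        next
          case False
          have "(\<Sum>J | J \<in> A \<and> S \<subseteq> J. c J * ?w' J k) = (\<Sum>J\<in>A. c J * ?w' J k)"
            using False off_top by (intro sum.mono_neutral_left) auto
          then show ?thesis
            using c by simp
        qed
        then show ?thesis
          using R top_iff independent_familyD[of ?w' "{J \<in> A. S \<subseteq> J}" c J] True \<open>J \<in> A\<close> by simp
      next
        case False
        then obtain a where a: "a \<in> S" "S - J = {a}"
          using cases[OF \<open>J \<in> A\<close>] by blast
        \<comment> \<open>The coordinate \<open>a\<close> sees no column of \<open>A\<close> other than \<open>J\<close>.\<close>
        have "?w' J' a = 0" if J': "J' \<in> A" "J' \<noteq> J" for J'
        proof (cases "S \<subseteq> J'")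
          case True
          then show ?thesis
            using w'_top[of J' a] a(1) by simp
        next
          case False
          then obtain b where b: "S - J' = {b}"
            using cases[OF J'(1)] by blast
          have "b \<noteq> a"
            using R a b J' \<open>J \<in> A\<close> by blast
          then show ?thesis
            using w'_one[OF b] by simp
        qed
        then have "(\<Sum>J\<in>A. c J * ?w' J a) = c J * ?w' J a"
          using \<open>J \<in> A\<close> by (subst sum.remove[of A J]) (auto intro!: sum.neutral)
        then have "c J * ?w' J a = 0"
          using c by simp
        moreover have "?w' J a \<noteq> 0"
          using R a \<open>J \<in> A\<close> assms(1) insertion_sign_nonzero[of J a, where 'a = 'a] by (auto simp: w'_one[OF a(2)])
        ultimately show ?thesis
          by simp
      qed
    qed
  qed
qed

text \<open>
  The sets \<open>J\<close> in a summand are recognised by \<open>S - J\<close>, so an independent set of the direct sum can be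
  taken apart again.  The resulting conditions are those of lemma \<open>independent_family_decompose\<close>.
\<close>

lemma direct_sum_summands:
  "ground (direct_sum (direct_sum (summand d S X) (summand_zero d S))
      (direct_sum_family S (summand_at d S q))) = {J. card J = d}" (is ?ground)
  "A \<in> indep (direct_sum (direct_sum (summand d S X) (summand_zero d S))
      (direct_sum_family S (summand_at d S q))) \<longleftrightarrow>
    (\<forall>J\<in>A. card J = d) \<and> {J \<in> A. S \<subseteq> J} \<in> indep (summand d S X) \<and>
    (\<forall>J\<in>A. \<not> 2 \<le> card (S - J)) \<and>
    (\<forall>a\<in>S. \<forall>J\<in>A. S - J = {a} \<longrightarrow> q $ (J \<union> {a}) \<noteq> 0 \<and> (\<forall>J'\<in>A. S - J' = {a} \<longrightarrow> J' = J))"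
    (is "?L \<longleftrightarrow> ?R")
proof -
  have small: "S \<subseteq> J \<or> (\<exists>a\<in>S. S - J = {a})" if "\<not> 2 \<le> card (S - J)" for J
  proof -
    have "card (S - J) = 0 \<or> card (S - J) = 1"
      using that by linarith
    then show ?thesis
      by (auto simp: card_1_singleton_iff)
  qed
  have ground_summand: "ground (summand d S X) = {J. card J = d \<and> S \<subseteq> J}"
    by (auto simp: summand_def matroid_restrict_def matroid_LS_def linear_matroid_def)
  have indep_at: "B \<in> indep (summand_at d S q a) \<longleftrightarrow>
      B = {} \<or> (\<exists>J. B = {J} \<and> card J = d \<and> S - J = {a} \<and> q $ (J \<union> {a}) \<noteq> 0)" for B a
    by (auto simp: summand_at_def rank_one_matroid_def)
  show ?ground
    using small
    by (auto simp: direct_sum_def direct_sum_family_def ground_summand summand_zero_def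
        rank_zero_matroid_def summand_at_def rank_one_matroid_def)
  have L: "?L \<longleftrightarrow> (\<exists>A1 B. A1 \<in> indep (summand d S X) \<and> (\<forall>a\<in>S. B a \<in> indep (summand_at d S q a)) \<and>
      A = A1 \<union> (\<Union>a\<in>S. B a))"
    by (auto simp: direct_sum_def direct_sum_family_def summand_zero_def rank_zero_matroid_def)
  show "?L \<longleftrightarrow> ?R"
  proof
    assume ?L
    then obtain A1 B where A1: "A1 \<in> indep (summand d S X)"
      and B: "\<And>a. a \<in> S \<Longrightarrow> B a \<in> indep (summand_at d S q a)" and A: "A = A1 \<union> (\<Union>a\<in>S. B a)"
      using L by blast
    have A1_top: "card J = d \<and> S \<subseteq> J" if "J \<in> A1" for J
      using A1 that
      by (auto simp: summand_def matroid_restrict_def matroid_LS_def linear_matroid_def)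
    have B_at: "card J = d \<and> S - J = {a} \<and> q $ (J \<union> {a}) \<noteq> 0 \<and> B a = {J}" if "a \<in> S" "J \<in> B a" for a J
      using B[OF that(1)] that(2) by (auto simp: indep_at)
    have in_B: "J \<in> B a" if "J \<in> A" "S - J = {a}" for J a
    proof -
      have "J \<notin> A1"
        using A1_top that(2) by blast
      then obtain b where "b \<in> S" "J \<in> B b"
        using \<open>J \<in> A\<close> A by blast
      then show ?thesis
        using B_at[of b J] that(2) by simp
    qed
    have "{J \<in> A. S \<subseteq> J} = A1"
      using A A1_top B_at by blast
    moreover have "\<not> 2 \<le> card (S - J)" if "J \<in> A" for J
    proof (cases "J \<in> A1")
      case True
      then have "S - J = {}"
        using A1_top by blast
      then show ?thesis
        by (metis card.empty not_numeral_le_zero)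
    next
      case False
      then obtain a where "a \<in> S" "J \<in> B a"
        using \<open>J \<in> A\<close> A by blast
      then have "card (S - J) = 1"
        using B_at[of a J] by simp
      then show ?thesis
        by simp
    qed
    moreover have "\<forall>J\<in>A. card J = d"
      using A A1_top B_at by blast
    moreover have "q $ (J \<union> {a}) \<noteq> 0 \<and> (\<forall>J'\<in>A. S - J' = {a} \<longrightarrow> J' = J)"
      if "a \<in> S" "J \<in> A" "S - J = {a}" for a J
      using B_at[OF that(1) in_B[OF that(2,3)]] in_B by blast
    ultimately show ?R
      using A1 by simp
  next
    assume R: ?R
    define B where "B a = {J \<in> A. S - J = {a}}" for a
    have "B a \<in> indep (summand_at d S q a)" if "a \<in> S" for a
    proof (cases "B a = {}")
      case False
      then obtain J where J: "J \<in> A" "S - J = {a}"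
        by (auto simp: B_def)
      then have "B a = {J}"
        using R that unfolding B_def by blast
      then show ?thesis
        using R that J by (simp add: indep_at)
    qed (simp add: indep_at)
    moreover have "A = {J \<in> A. S \<subseteq> J} \<union> (\<Union>a\<in>S. B a)"
    proof
      show "A \<subseteq> {J \<in> A. S \<subseteq> J} \<union> (\<Union>a\<in>S. B a)"
      proof
        fix J assume "J \<in> A"
        then show "J \<in> {J \<in> A. S \<subseteq> J} \<union> (\<Union>a\<in>S. B a)"
          using R small[of J] by (auto simp: B_def)
      qed
    qed (auto simp: B_def)
    ultimately show ?L
      unfolding L using R by (intro exI[of _ "{J \<in> A. S \<subseteq> J}"] exI[of _ B]) simp
  qed
qed

theorem proposition18:
  fixes X :: "('a::alg_closed_field ^ 'n::{finite,linorder}) set"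
    and q :: "'a ^ ('n set)"
    and S :: "'n set"
    and d :: nat
  assumes "1 \<le> d" and "d \<le> CARD('n) - 1"
    and "vec.subspace X" and "vec.dim X = d + 1"
    and "is_pluecker_vector (d + 1) X q"
    and "\<exists>C. card C = d + 1 \<and> S \<subseteq> C \<and> q $ C \<noteq> 0"
  shows "matroid_LS d S X =
      direct_sum (direct_sum (summand d S X) (summand_zero d S))
        (direct_sum_family S (summand_at d S q)) \<and>
    is_matroid (matroid_LS d S X) \<and> is_matroid (summand d S X) \<and>
    is_matroid (summand_zero d S) \<and> matroid_rank (summand_zero d S) = 0 \<and>
    (\<forall>a\<in>S. is_matroid (summand_at d S q a) \<and> matroid_rank (summand_at d S q a) = 1)"
proof -
  obtain C where C: "card C = d + 1" "S \<subseteq> C" "q $ C \<noteq> 0"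
    using assms(6) by blast
  let ?X' = "{v. pr S v \<in> X}"
  obtain r where r: "r \<noteq> 0" "is_pluecker_vector (d + 1) ?X' (\<chi> I. if S \<subseteq> I then r * q $ I else 0)"
    using pluecker_vector_pr_vimage(2)[OF assms(3-5) C] by blast
  define q' where "q' = (\<chi> I. if S \<subseteq> I then r * q $ I else 0)"
  \<comment> \<open>The condition \<open>pr S ` Y \<subseteq> X\<close> just says \<open>Y \<subseteq> ?X'\<close>.\<close>
  have "LS d S X = L d ?X'"
    unfolding LS_empty by (auto simp: LS_def)
  then have cone': "pluecker_cone d (LS d S X) = range (contraction d q')"
    using pluecker_cone_hyperplanes[of ?X' d q'] vec_subspace_pr_vimage[OF assms(3)]
      pluecker_vector_pr_vimage(1)[OF assms(3-5) C] r(2) assms(1) by (simp add: q'_def)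
  have cone: "pluecker_cone d (L d X) = range (contraction d q)"
    using assms(1,3-5) by (intro pluecker_cone_hyperplanes) auto
  have indep_LS: "A \<in> indep (matroid_LS d S X) \<longleftrightarrow> (\<forall>J\<in>A. card J = d) \<and>
      independent_family (contraction_column q) {J \<in> A. S \<subseteq> J} \<and>
      (\<forall>J\<in>A. \<not> 2 \<le> card (S - J)) \<and>
      (\<forall>a\<in>S. \<forall>J\<in>A. S - J = {a} \<longrightarrow> q $ (J \<union> {a}) \<noteq> 0 \<and> (\<forall>J'\<in>A. S - J' = {a} \<longrightarrow> J' = J))" for A
    unfolding matroid_LS_def cone' indep_linear_matroid_contraction
    using independent_family_decompose[OF r(1), of q' S q A] by (simp add: q'_def)
  have indep_summand: "A \<in> indep (summand d S X) \<longleftrightarrow>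
      (\<forall>J\<in>A. card J = d \<and> S \<subseteq> J) \<and> independent_family (contraction_column q) A" for A
    by (auto simp: summand_def matroid_restrict_def matroid_LS_def cone indep_linear_matroid_contraction)
  have "indep (matroid_LS d S X) =
      indep (direct_sum (direct_sum (summand d S X) (summand_zero d S))
        (direct_sum_family S (summand_at d S q)))"
  proof (rule Set.set_eqI)
    fix A
    show "A \<in> indep (matroid_LS d S X) \<longleftrightarrow>
        A \<in> indep (direct_sum (direct_sum (summand d S X) (summand_zero d S))
          (direct_sum_family S (summand_at d S q)))"
      unfolding direct_sum_summands(2) indep_LS indep_summand by blast
  qed
  moreover have "ground (matroid_LS d S X) = {J. card J = d}"
    by (simp add: matroid_LS_def linear_matroid_def)
  ultimately have decomposition: "matroid_LS d S X =
      direct_sum (direct_sum (summand d S X) (summand_zero d S))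
        (direct_sum_family S (summand_at d S q))"
    by (intro matroid.expand) (simp add: direct_sum_summands(1))
  have "matroid_rank (summand_at d S q a) = 1" if "a \<in> S" for a
  proof -
    let ?J = "C - {a}"
    have "a \<in> C"
      using that C(2) by blast
    then have "card ?J = d" "S - ?J = {a}" "?J \<union> {a} = C"
      using C(1,2) that by auto
    then have "{?J} \<in> indep (summand_at d S q a)"
      using C(3) by (auto simp: summand_at_def rank_one_matroid_def)
    moreover have "card B \<le> 1" if "B \<in> indep (summand_at d S q a)" for B
      using that by (auto simp: summand_at_def rank_one_matroid_def)
    ultimately show ?thesis
      unfolding matroid_rank_def by (intro Max_eqI) (auto intro: rev_image_eqI)
  qed
  moreover have "is_matroid (matroid_LS d {} X)" "is_matroid (matroid_LS d S X)"
    unfolding matroid_LS_def cone cone'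
    by (intro is_matroid_linear_matroid subspace_range_contraction)+
  moreover have "matroid_rank (summand_zero d S) = 0"
    by (simp add: matroid_rank_def summand_zero_def rank_zero_matroid_def)
  ultimately show ?thesis
    using decomposition
    by (simp add: summand_def is_matroid_restrict summand_zero_def is_matroid_rank_zero
        summand_at_def is_matroid_rank_one)
qed

end
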